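(* Consider the system, constraints, cost functions, sets and Algorithm 1 described in the context, and suppose that: (i) $(A,B)$ is stabilizable, and $K$ is such that $A_K=A+BK$ is Schur stable; (ii) $\mathcal Y\subseteq\mathbb R^p$ is compact, convex and $0\in\operatorname{int}\mathcal Y$; (iii) $\mathcal W\subseteq\mathbb R^o$ is compact, convex, $0\in\operatorname{int}\mathcal W$, and $w_t\in\mathcal W$ for all $t\in\mathbb N$; (iv) there are constants $l_L,\alpha_v,l_v>0$ such that for all $t\in\mathbb N$: $|L_t(u,x)-L_t(\tilde u,\tilde x)|\le l_L\|(u,x)-(\tilde u,\tilde x)\|$ for all $(u,x),(\tilde u,\tilde x)\in\mathcal Z:=\{(u,x)\in\mathbb R^m\times\mathbb R^n: C_ox+Du\in\mathcal Y\}$, and the steady-state cost $L_t^s(v):=L_t(v+KS_Kv,\,S_Kv)$ is $\alpha_v$-strongly convex with $l_v$-Lipschitz continuous gradient on $\mathcal S_v$; (v) the initial reference $r_0\in\overline{\mathcal S}_v$ satisfies $(r_0,x_0-S_Kr_0)\in\mathcal O_\infty^\lambda$; (vi) $\gamma\in\left(0,\frac{2}{\alpha_v+l_v}\right]$. Then there exist constants $c_0,c_\eta,c_w>0$ such that the closed loop resulting from Algorithm 1 satisfies $$\mathcal R_T\le c_0+c_\eta\sum_{t=1}^T\|\eta_t-\eta_{t-1}\|+c_w\sum_{t=0}^{T-1}\|w_t\|$$ for any $T\in\mathbb N$, any sequence of disturbances $w_t$ (as in (iii)), and any sequence of cost functions $L_t$ (as in (iv)).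
   Context: Notation: $\mathbb N$ includes $0$; $\|\cdot\|$ is the Euclidean norm; $\mathcal S\oplus\mathcal T=\{s+t:s\in\mathcal S,t\in\mathcal T\}$; $\mathcal S\ominus\mathcal T=\{s: s+t\in\mathcal S\ \forall t\in\mathcal T\}$; $\Pi_{\mathcal S}(x)=\arg\min_{s\in\mathcal S}\|x-s\|^2$; $\rho(\cdot)$ is the spectral radius; Schur stable means $\rho<1$. System: $x_{t+1}=Ax_t+Bu_t+B_ww_t$, $x_t\in\mathbb R^n$, $u_t\in\mathbb R^m$, $w_t\in\mathbb R^o$, with given initial state $x_0$, constraint output $y_t=C_ox_t+Du_t+D_ww_t\in\mathbb R^p$, and constraints $y_t\in\mathcal Y$ for all $t\in\mathbb N$. The state $x_t$ is measured. Fix $K\in\mathbb R^{m\times n}$ with $A_K:=A+BK$ Schur stable, and put $u_t=v_t+Kx_t$ with virtual reference $v_t\in\mathbb R^m$. With $C:=C_o+DK$ this gives $x_{t+1}=A_Kx_t+Bv_t+B_ww_t$ and $y_t=Cx_t+Dv_t+D_ww_t$. Let $S_K:=(I_n-A_K)^{-1}B$ and $\mathcal S_v:=\{v\in\mathbb R^m:(CS_K+D)v\in\mathcal Y\ominus D_w\mathcal W\}$. Cost functions: $L_t:\mathbb R^m\times\mathbb R^n\to\mathbb R$, with arguments (input, state), are time-varying; at time $t$ only $L_0,\dots,L_{t-1}$ are known. Maximal output admissible set: fix $\lambda$ with $\rho(A_K)<\lambda<1$. $\mathcal O_\infty^\lambda$ is the set of all $(v,\epsilon)\in\mathbb R^m\times\mathbb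 R^n$ such that, with $\epsilon_0=\epsilon$ and $\epsilon_{t+1}=\frac1\lambda(A_K\epsilon_t+B_w\omega_t)$, one has $C\epsilon_t+(CS_K+D)v+D_w\omega_t\in\mathcal Y$ for all $t\in\mathbb N$ and all sequences $\omega_t\in\mathcal W$. Constraint tightening: $\mathcal P^\lambda\subseteq\mathbb R^n$ is a robust positively invariant set for $\epsilon_{t+1}=\frac1\lambda(A_K\epsilon_t+B_w\omega_t)$, $\omega_t\in\mathcal W$, i.e. $\frac1\lambda A_K\mathcal P^\lambda\oplus\frac1\lambda B_w\mathcal W\subseteq\mathcal P^\lambda$, containing the minimal such set: $\mathcal P^\lambda_\infty:=\bigoplus_{i=0}^\infty\left(\left(\frac1\lambda A_K\right)^i\frac1\lambda B_w\mathcal W\right)\subseteq\mathcal P^\lambda$. $\overline{\mathcal Y}$ is a convex, compact set with $0\in\overline{\mathcal Y}\subseteq\operatorname{int}\mathcal Y$. The tightened reference set is $\overline{\mathcal S}_v:=\{v\in\mathbb R^m:(CS_K+D)v\in\overline{\mathcal Y}\ominus D_w\mathcal W\ominus C\mathcal P^\lambda\}$. Algorithm 1 (robust OCO-RG scheme) with step size $\gamma$: at $t=0$ set $\alpha_0=1$, $v_0=r_0$, and apply $u_0=v_0+Kx_0$. At each $t\ge1$, given $x_t$: [S1] $r_t=\Pi_{\overline{\mathcal S}_v}\left(r_{t-1}-\gamma\nabla L^s_{t-1}(r_{t-1})\right)$; [S2] $\alpha_t$ is the maximal $\alpha\in[0,1]$ such that $v:=v_{t-1}+\alpha(r_t-v_{t-1})$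 satisfies $(v,x_t-S_Kv)\in\mathcal O_\infty^\lambda$, and $v_t=v_{t-1}+\alpha_t(r_t-v_{t-1})$; [S3] apply $u_t=v_t+Kx_t$. Optimal steady states: $\eta_t:=\arg\min_{r\in\overline{\mathcal S}_v}L_t^s(r)$, $\theta_t:=S_K\eta_t$. Dynamic regret: $\mathcal R_T:=\sum_{t=0}^T\left[L_t(u_t,x_t)-L_t(\eta_t+K\theta_t,\theta_t)\right]$, where $(u_t,x_t)$ is the closed-loop trajectory of Algorithm 1. *)

theory Defs
  imports "HOL-Analysis.Analysis"
begin

section \<open>Matrices and sets\<close>

definition spectral_radius :: "real^'n^'n \<Rightarrow> real" where
  "spectral_radius A =
     Max {cmod \<mu> |\<mu>. \<exists>z. z \<noteq> 0 \<and> map_matrix complex_of_real A *v z = \<mu> *s z}"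

definition schur_stable :: "real^'n^'n \<Rightarrow> bool" where
  "schur_stable A \<longleftrightarrow> spectral_radius A < 1"

definition stabilizable :: "real^'n^'n \<Rightarrow> real^'m^'n \<Rightarrow> bool" where
  "stabilizable A B \<longleftrightarrow> (\<exists>F :: real^'n^'m. schur_stable (A + B ** F))"

text \<open>The Minkowski sum of two sets is \<open>+\<close> from \<^theory>\<open>HOL-Library.Set_Algebras\<close>.\<close>

definition pontryagin_diff :: "'a::plus set \<Rightarrow> 'a set \<Rightarrow> 'a set" (infixl "\<ominus>" 65) where
  "S \<ominus> T = {s. \<forall>t\<in>T. s + t \<in> S}"

definition minkowski_series :: "(nat \<Rightarrow> 'a::real_normed_vector set) \<Rightarrow> 'a set" where
  "minkowski_series S = {s. \<exists>f. (\<forall>i. f i \<in> S i) \<and> f sums s}"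


section \<open>Functions\<close>

definition grad :: "('a::real_inner \<Rightarrow> real) \<Rightarrow> 'a \<Rightarrow> 'a" where
  "grad f x = (THE g. GDERIV f x :> g)"

definition strongly_convex_on :: "real \<Rightarrow> 'a::real_normed_vector set \<Rightarrow> ('a \<Rightarrow> real) \<Rightarrow> bool" where
  "strongly_convex_on \<alpha> S f \<longleftrightarrow>
     (\<forall>x\<in>S. \<forall>y\<in>S. \<forall>s\<in>{0..1}.
        f ((1 - s) *\<^sub>R x + s *\<^sub>R y)
          \<le> (1 - s) * f x + s * f y - \<alpha> / 2 * s * (1 - s) * (norm (x - y))\<^sup>2)"

text \<open>Only differentiability relative to \<open>S\<close> is demanded, so nothing is assumed about \<open>f\<close>
  outside \<open>S\<close>; at interior points of \<open>S\<close> the vector \<open>g x\<close> is \<^term>\<open>grad f x\<close>.\<close>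

definition lipschitz_gradient_on :: "real \<Rightarrow> 'a::real_inner set \<Rightarrow> ('a \<Rightarrow> real) \<Rightarrow> bool" where
  "lipschitz_gradient_on l S f \<longleftrightarrow>
     (\<exists>g. (\<forall>x\<in>S. (f has_derivative (\<lambda>h. g x \<bullet> h)) (at x within S)) \<and> l-lipschitz_on S g)"


section \<open>The prestabilized system\<close>

record ('n, 'm, 'o, 'p) control_system =
  mat_A :: "real^'n^'n"
  mat_B :: "real^'m^'n"
  mat_Bw :: "real^'o^'n"
  mat_Co :: "real^'n^'p"
  mat_D :: "real^'m^'p"
  mat_Dw :: "real^'o^'p"
  mat_K :: "real^'n^'m"

definition A_K :: "('n::finite, 'm::finite, 'o::finite, 'p::finite) control_system \<Rightarrow> real^'n^'n" where
  "A_K \<Sigma> = mat_A \<Sigma> + mat_B \<Sigma> ** mat_K \<Sigma>"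

definition C_K :: "('n::finite, 'm::finite, 'o::finite, 'p::finite) control_system \<Rightarrow> real^'n^'p" where
  "C_K \<Sigma> = mat_Co \<Sigma> + mat_D \<Sigma> ** mat_K \<Sigma>"

definition S_K :: "('n::finite, 'm::finite, 'o::finite, 'p::finite) control_system \<Rightarrow> real^'m^'n" where
  "S_K \<Sigma> = matrix_inv (mat 1 - A_K \<Sigma>) ** mat_B \<Sigma>"

definition output_gain :: "('n::finite, 'm::finite, 'o::finite, 'p::finite) control_system \<Rightarrow> real^'m^'p" where
  "output_gain \<Sigma> = C_K \<Sigma> ** S_K \<Sigma> + mat_D \<Sigma>"

text \<open>\<open>\<S>\<^sub>v\<close>, its tightened version, and the set \<open>\<Z>\<close> of pairs (input, state).\<close>

definition steady_refs ::
  "('n::finite, 'm::finite, 'o::finite, 'p::finite) control_system \<Rightarrow> (real^'p) set \<Rightarrow> (real^'o) set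
     \<Rightarrow> (real^'m) set" where
  "steady_refs \<Sigma> Y W = {v. output_gain \<Sigma> *v v \<in> Y \<ominus> (*v) (mat_Dw \<Sigma>) ` W}"

definition tightened_refs ::
  "('n::finite, 'm::finite, 'o::finite, 'p::finite) control_system \<Rightarrow> (real^'p) set \<Rightarrow> (real^'o) set
     \<Rightarrow> (real^'n) set \<Rightarrow> (real^'m) set" where
  "tightened_refs \<Sigma> Ybar W P =
     {v. output_gain \<Sigma> *v v \<in> Ybar \<ominus> (*v) (mat_Dw \<Sigma>) ` W \<ominus> (*v) (C_K \<Sigma>) ` P}"

definition admissible_pairs ::
  "('n::finite, 'm::finite, 'o::finite, 'p::finite) control_system \<Rightarrow> (real^'p) set
     \<Rightarrow> ((real^'m) \<times> (real^'n)) set" where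
  "admissible_pairs \<Sigma> Y = {(u, x). mat_Co \<Sigma> *v x + mat_D \<Sigma> *v u \<in> Y}"


section \<open>Invariant sets of the scaled error dynamics\<close>

primrec scaled_error ::
  "('n::finite, 'm::finite, 'o::finite, 'p::finite) control_system \<Rightarrow> real \<Rightarrow> (nat \<Rightarrow> real^'o)
     \<Rightarrow> real^'n \<Rightarrow> nat \<Rightarrow> real^'n" where
  "scaled_error \<Sigma> lam \<omega> \<epsilon> 0 = \<epsilon>"
| "scaled_error \<Sigma> lam \<omega> \<epsilon> (Suc t) =
     (1 / lam) *\<^sub>R (A_K \<Sigma> *v scaled_error \<Sigma> lam \<omega> \<epsilon> t + mat_Bw \<Sigma> *v \<omega> t)"

definition max_output_admissible ::
  "('n::finite, 'm::finite, 'o::finite, 'p::finite) control_system \<Rightarrow> real \<Rightarrow> (real^'p) set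
     \<Rightarrow> (real^'o) set \<Rightarrow> ((real^'m) \<times> (real^'n)) set" where
  "max_output_admissible \<Sigma> lam Y W =
     {(v, \<epsilon>). \<forall>\<omega>. (\<forall>t. \<omega> t \<in> W) \<longrightarrow>
        (\<forall>t. C_K \<Sigma> *v scaled_error \<Sigma> lam \<omega> \<epsilon> t + output_gain \<Sigma> *v v + mat_Dw \<Sigma> *v \<omega> t \<in> Y)}"

definition scaled_map ::
  "('n::finite, 'm::finite, 'o::finite, 'p::finite) control_system \<Rightarrow> real \<Rightarrow> real^'n \<Rightarrow> real^'n" where
  "scaled_map \<Sigma> lam \<epsilon> = (1 / lam) *\<^sub>R (A_K \<Sigma> *v \<epsilon>)"

definition scaled_noise ::
  "('n::finite, 'm::finite, 'o::finite, 'p::finite) control_system \<Rightarrow> real \<Rightarrow> (real^'o) set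
     \<Rightarrow> (real^'n) set" where
  "scaled_noise \<Sigma> lam W = (\<lambda>\<omega>. (1 / lam) *\<^sub>R (mat_Bw \<Sigma> *v \<omega>)) ` W"

definition robust_invariant ::
  "('n::finite, 'm::finite, 'o::finite, 'p::finite) control_system \<Rightarrow> real \<Rightarrow> (real^'o) set
     \<Rightarrow> (real^'n) set \<Rightarrow> bool" where
  "robust_invariant \<Sigma> lam W P \<longleftrightarrow> scaled_map \<Sigma> lam ` P + scaled_noise \<Sigma> lam W \<subseteq> P"

definition min_robust_invariant ::
  "('n::finite, 'm::finite, 'o::finite, 'p::finite) control_system \<Rightarrow> real \<Rightarrow> (real^'o) set
     \<Rightarrow> (real^'n) set" where
  "min_robust_invariant \<Sigma> lam W =
     minkowski_series (\<lambda>i. (scaled_map \<Sigma> lam ^^ i) ` scaled_noise \<Sigma> lam W)"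


section \<open>Costs, algorithm and regret\<close>

text \<open>Costs take the pair (input, state); the norm on the product type is the Euclidean one.\<close>

definition steady_cost ::
  "('n::finite, 'm::finite, 'o::finite, 'p::finite) control_system \<Rightarrow> ((real^'m) \<times> (real^'n) \<Rightarrow> real)
     \<Rightarrow> real^'m \<Rightarrow> real" where
  "steady_cost \<Sigma> L v = L (v + mat_K \<Sigma> *v (S_K \<Sigma> *v v), S_K \<Sigma> *v v)"

text \<open>The step size \<open>\<alpha>\<^sub>t\<close> from the state \<open>x = x\<^sub>t\<close>, previous reference \<open>v = v\<^sub>t\<^sub>-\<^sub>1\<close> and target
  \<open>r = r\<^sub>t\<close>, where \<open>Omega\<close> stands for the output admissible set.\<close>

definition governor_step ::
  "('n::finite, 'm::finite, 'o::finite, 'p::finite) control_system \<Rightarrow> ((real^'m) \<times> (real^'n)) set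
     \<Rightarrow> real^'n \<Rightarrow> real^'m \<Rightarrow> real^'m \<Rightarrow> real" where
  "governor_step \<Sigma> Omega x v r =
     (GREATEST \<alpha>. \<alpha> \<in> {0..1} \<and>
        (v + \<alpha> *\<^sub>R (r - v), x - S_K \<Sigma> *v (v + \<alpha> *\<^sub>R (r - v))) \<in> Omega)"

text \<open>The closed loop: its value at time \<open>t\<close> is \<open>(x\<^sub>t, v\<^sub>t, r\<^sub>t)\<close>.\<close>

primrec closed_loop ::
  "('n::finite, 'm::finite, 'o::finite, 'p::finite) control_system
     \<Rightarrow> ((real^'m) \<times> (real^'n)) set \<Rightarrow> (real^'m) set \<Rightarrow> real
     \<Rightarrow> real^'n \<Rightarrow> real^'m \<Rightarrow> (nat \<Rightarrow> (real^'m) \<times> (real^'n) \<Rightarrow> real) \<Rightarrow> (nat \<Rightarrow> real^'o)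
     \<Rightarrow> nat \<Rightarrow> (real^'n) \<times> (real^'m) \<times> (real^'m)" where
  "closed_loop \<Sigma> Omega Sbar \<gamma> x0 r0 L w 0 = (x0, r0, r0)"
| "closed_loop \<Sigma> Omega Sbar \<gamma> x0 r0 L w (Suc t) =
     (let (x, v, r) = closed_loop \<Sigma> Omega Sbar \<gamma> x0 r0 L w t;
          u = v + mat_K \<Sigma> *v x;
          x' = mat_A \<Sigma> *v x + mat_B \<Sigma> *v u + mat_Bw \<Sigma> *v w t;
          r' = closest_point Sbar (r - \<gamma> *\<^sub>R grad (steady_cost \<Sigma> (L t)) r);
          v' = v + governor_step \<Sigma> Omega x' v r' *\<^sub>R (r' - v)
      in (x', v', r'))"

text \<open>The pair \<open>(u\<^sub>t, x\<^sub>t)\<close>.\<close>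

definition closed_loop_pair ::
  "('n::finite, 'm::finite, 'o::finite, 'p::finite) control_system
     \<Rightarrow> ((real^'m) \<times> (real^'n)) set \<Rightarrow> (real^'m) set \<Rightarrow> real
     \<Rightarrow> real^'n \<Rightarrow> real^'m \<Rightarrow> (nat \<Rightarrow> (real^'m) \<times> (real^'n) \<Rightarrow> real) \<Rightarrow> (nat \<Rightarrow> real^'o)
     \<Rightarrow> nat \<Rightarrow> (real^'m) \<times> (real^'n)" where
  "closed_loop_pair \<Sigma> Omega Sbar \<gamma> x0 r0 L w t =
     (let (x, v, r) = closed_loop \<Sigma> Omega Sbar \<gamma> x0 r0 L w t in (v + mat_K \<Sigma> *v x, x))"

text \<open>The optimal steady-state reference \<open>\<eta>\<^sub>t\<close>; the optimal steady state is
  \<open>\<theta>\<^sub>t = S\<^sub>K \<eta>\<^sub>t\<close>.\<close>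

definition opt_ref ::
  "('n::finite, 'm::finite, 'o::finite, 'p::finite) control_system \<Rightarrow> (real^'m) set
     \<Rightarrow> (nat \<Rightarrow> (real^'m) \<times> (real^'n) \<Rightarrow> real) \<Rightarrow> nat \<Rightarrow> real^'m" where
  "opt_ref \<Sigma> Sbar L t = arg_min_on (steady_cost \<Sigma> (L t)) Sbar"

definition regret ::
  "('n::finite, 'm::finite, 'o::finite, 'p::finite) control_system
     \<Rightarrow> ((real^'m) \<times> (real^'n)) set \<Rightarrow> (real^'m) set \<Rightarrow> real
     \<Rightarrow> real^'n \<Rightarrow> real^'m \<Rightarrow> (nat \<Rightarrow> (real^'m) \<times> (real^'n) \<Rightarrow> real) \<Rightarrow> (nat \<Rightarrow> real^'o)
     \<Rightarrow> nat \<Rightarrow> real" where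
  "regret \<Sigma> Omega Sbar \<gamma> x0 r0 L w T =
     (\<Sum>t=0..T. L t (closed_loop_pair \<Sigma> Omega Sbar \<gamma> x0 r0 L w t)
        - (let \<eta> = opt_ref \<Sigma> Sbar L t; \<theta> = S_K \<Sigma> *v \<eta> in L t (\<eta> + mat_K \<Sigma> *v \<theta>, \<theta>)))"

end

theory Submission
  imports Defs "HOL-Computational_Algebra.Fundamental_Theorem_Algebra"
begin

text \<open>Since the cost is \<open>l\<^sub>L\<close>-Lipschitz on admissible pairs, the regret is at most a multiple of
  \<open>\<Sum> \<parallel>e\<^sub>t\<parallel> + \<Sum> \<parallel>v\<^sub>t - \<eta>\<^sub>t\<parallel>\<close> with \<open>e\<^sub>t = x\<^sub>t - S\<^sub>K v\<^sub>t\<close>, and three linear recursions control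
  these sums. First, \<open>\<rho>\<^sub>t = \<parallel>r\<^sub>t - \<eta>\<^sub>t\<parallel>\<close> contracts up to \<open>\<parallel>\<eta>\<^sub>t\<^sub>+\<^sub>1 - \<eta>\<^sub>t\<parallel>\<close>, because a projected gradient step
  is a contraction; as the gradient is controlled only on \<open>\<S>\<^sub>v\<close>, this is shown for nearby points
  and then extended along segments of the tightened set. Second, \<open>\<sigma>\<^sub>t = \<parallel>v\<^sub>t - r\<^sub>t\<parallel>\<close> contracts up to
  \<open>2 \<rho>\<^sub>t\<close>, because the scaling by \<open>\<lambda>\<close> in the output admissible set and the margin of the tightened
  constraints always leave room for a fixed fraction of the step from \<open>v\<^sub>t\<close> to \<open>r\<^sub>t\<^sub>+\<^sub>1\<close>. Third,
  \<open>e\<^sub>t\<close> obeys the stable dynamics \<open>A\<^sub>K\<close> driven by \<open>B\<^sub>w w\<^sub>t\<close> and \<open>S\<^sub>K (v\<^sub>t\<^sub>+\<^sub>1 - v\<^sub>t)\<close>. The constants are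
  uniform because a strongly convex Lipschitz cost bounds the diameter of \<open>\<S>\<^sub>v\<close>.\<close>

section \<open>Powers of a matrix and its spectral radius\<close>

text \<open>This is p(A) z in Horner form, without the matrix p(A) being formed: the fold hands A z
  on to the higher coefficients.\<close>

definition poly_op :: "'a::field^'n^'n \<Rightarrow> 'a poly \<Rightarrow> 'a^'n \<Rightarrow> 'a^'n" where
  "poly_op A p = fold_coeffs (\<lambda>a g z. a *s z + g (A *v z)) p (\<lambda>_. 0)"

lemma poly_op_0 [simp]: "poly_op A 0 z = 0"
  by (simp add: poly_op_def)

lemma poly_op_pCons [simp]: "poly_op A (pCons a p) z = a *s z + poly_op A p (A *v z)"
proof (cases "a = 0 \<and> p = 0")
  case True
  then show ?thesis by simp
next
  case False
  then have "a = 0 \<longrightarrow> p \<noteq> 0" by simp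
  then show ?thesis
    unfolding poly_op_def by (cases "p = 0") (simp_all add: fold_coeffs_pCons_coeff_not_0_eq fold_coeffs_pCons_not_0_0_eq)
qed

lemma poly_op_add: "poly_op A (p + q) z = poly_op A p z + poly_op A q z"
  by (induction p q arbitrary: z rule: poly_induct2) (simp_all add: vec.scale_left_distrib algebra_simps)

lemma poly_op_smult: "poly_op A (smult c p) z = c *s poly_op A p z"
  by (induction p arbitrary: z) (simp_all add: vec.scale_right_distrib)

lemma poly_op_sum: "poly_op A (\<Sum>i\<in>I. p i) z = (\<Sum>i\<in>I. poly_op A (p i) z)"
  by (induction I rule: infinite_finite_induct) (simp_all add: poly_op_add)

lemma poly_op_monom: "poly_op A (monom a i) z = a *s ((*v) A ^^ i) z"
  by (induction i arbitrary: z) (simp_all add: monom_0 monom_Suc funpow_swap1)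

lemma poly_op_diff_vec:
  "poly_op A p (x - c *s y) = poly_op A p x - c *s poly_op A p y"
proof (induction p arbitrary: x y)
  case 0
  then show ?case by simp
next
  case (pCons a p)
  have "A *v (x - c *s y) = A *v x - c *s (A *v y)"
    by (simp add: vec.diff vec.scale)
  then show ?case
    using pCons.IH
    by (simp add: vec.scale_right_distrib vec.scale_right_diff_distrib mult.commute)
qed

lemma poly_op_scale: "poly_op A p (c *s z) = c *s poly_op A p z"
  using poly_op_diff_vec[of A p 0 "- c" z] poly_op_diff_vec[of A p 0 1 0] by simp

lemma poly_op_commute: "poly_op A p (A *v z) = A *v poly_op A p z"
  by (induction p arbitrary: z) (simp_all add: vec.add vec.scale)

text \<open>Splitting off one root is what lowers the degree in the growth estimate for the powers
  of A.\<close>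

lemma poly_op_linear_factor:
  "poly_op A ([:- \<mu>, 1:] * q) z = poly_op A q (A *v z - \<mu> *s z)"
proof -
  have "[:- \<mu>, 1:] * q = smult (- \<mu>) q + pCons 0 q" by simp
  then show ?thesis
    by (simp only: poly_op_add poly_op_smult poly_op_diff_vec poly_op_pCons) simp
qed

lemma poly_op_eigenvector:
  assumes "A *v z = \<mu> *s z"
  shows "poly_op A p z = poly p \<mu> *s z"
  using assms
  by (induction p)
     (simp_all add: poly_op_commute poly_op_scale vec.scale vec.scale_left_distrib mult.commute)

primrec mat_pow :: "'a::semiring_1^'n^'n \<Rightarrow> nat \<Rightarrow> 'a^'n^'n" where
  "mat_pow A 0 = mat 1"
| "mat_pow A (Suc k) = A ** mat_pow A k"

lemma mat_pow_mult_vec: "mat_pow (A :: 'a::comm_semiring_1^'n^'n) k *v z = ((*v) A ^^ k) z"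
  by (induction k) (simp_all flip: matrix_vector_mul_assoc)

text \<open>More powers of A than the dimension of the matrix space are linearly dependent. This
  weak form of Cayley-Hamilton suffices, as the degree does not matter.\<close>

lemma annihilating_poly:
  fixes A :: "complex^'n^'n"
  obtains p where "p \<noteq> 0" "\<And>z. poly_op A p z = 0"
proof -
  define N where "N = DIM(complex^'n^'n)"
  show thesis
  \<comment> \<open>\<open>dependent\<close> speaks of a set and does not see repetitions; two equal
    powers are therefore treated apart and give a difference of monomials.\<close>
  proof (cases "inj_on (mat_pow A) {..N}")
    case True
    then have "card (mat_pow A ` {..N}) = Suc N"
      by (simp add: card_image)
    then have "dependent (mat_pow A ` {..N})"
      using N_def dependent_biggerset by (metis lessI)
    then obtain u v where v: "v \<in> mat_pow A ` {..N}" "u v \<noteq> 0"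
      and sum: "(\<Sum>v\<in>mat_pow A ` {..N}. u v *\<^sub>R v) = 0"
      by (auto simp: dependent_finite)
    define p where "p = (\<Sum>i\<le>N. monom (complex_of_real (u (mat_pow A i))) i)"
    have "poly_op A p z = 0" for z
    proof -
      have "poly_op A p z = (\<Sum>i\<le>N. (u (mat_pow A i) *\<^sub>R mat_pow A i) *v z)"
        by (simp add: p_def poly_op_sum poly_op_monom flip: mat_pow_mult_vec)
           (simp add: vec_eq_iff matrix_vector_mult_def scaleR_sum_right sum_distrib_left scaleR_conv_of_real[where 'a=complex] mult.assoc)
      also have "\<dots> = (\<Sum>i\<le>N. u (mat_pow A i) *\<^sub>R mat_pow A i) *v z"
        by (induction N) (simp_all add: matrix_vector_mult_add_rdistrib)
      also have "(\<Sum>i\<le>N. u (mat_pow A i) *\<^sub>R mat_pow A i) = 0"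
        using sum True by (simp add: sum.reindex)
      finally show ?thesis by simp
    qed
    moreover have "p \<noteq> 0"
    proof -
      obtain j where j: "j \<le> N" "v = mat_pow A j" using v by auto
      have "coeff p j = complex_of_real (u v)"
        using j by (simp add: p_def coeff_sum)
      then show ?thesis using v by auto
    qed
    ultimately show ?thesis using that by blast
  next
    case False
    then obtain i j where ij: "i \<noteq> j" "mat_pow A i = mat_pow A j"
      by (auto simp: inj_on_def)
    define p where "p = monom (1::complex) i + monom (- 1) j"
    have "coeff p i = 1" using ij by (simp add: p_def)
    then have "p \<noteq> 0" by auto
    moreover have "poly_op A p z = 0" for z
      using ij by (simp add: p_def poly_op_add poly_op_monom flip: mat_pow_mult_vec)
    ultimately show ?thesis using that by blast
  qed
qed

section \<open>Growth of the powers in terms of the eigenvalues\<close>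

lemma norm_vector_smult: "norm (c *s z) = cmod c * norm (z :: complex^'n)"
  by (simp add: norm_vec_def norm_mult L2_set_right_distrib)

text \<open>Induction on the degree replaces the Jordan form. A root \<mu> is split off: if it is no
  eigenvalue, A - \<mu> is injective and the quotient already annihilates z; otherwise |\<mu>| < r,
  and the bound for (A - \<mu>) z passes to z through a scalar recursion. The case r = 0 without
  eigenvalues is included and later yields that eigenvalues exist.\<close>

lemma power_bound_of_annihilated:
  fixes A :: "complex^'n^'n"
  assumes eig: "\<And>\<mu> z. z \<noteq> 0 \<Longrightarrow> A *v z = \<mu> *s z \<Longrightarrow> cmod \<mu> < r"
    and "p \<noteq> 0" "poly_op A p z = 0"
  shows "\<exists>M. \<forall>k. norm (((*v) A ^^ k) z) \<le> M * r ^ k"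
  using assms(2,3)
proof (induction "degree p" arbitrary: p z)
  case 0
  then obtain a where "p = [:a:]"
    by (metis degree_eq_zeroE)
  with 0 have "z = 0" by simp
  moreover have "((*v) A ^^ k) 0 = 0" for k
    by (induction k) auto
  ultimately show ?case
    by (intro exI[of _ 0]) simp
next
  case (Suc d)
  have "\<not> constant (poly p)"
    using Suc.hyps(2) by (simp add: constant_degree)
  then obtain \<mu> where "poly p \<mu> = 0"
    using fundamental_theorem_of_algebra by blast
  then obtain q where p: "p = [:- \<mu>, 1:] * q"
    by (metis poly_eq_0_iff_dvd dvdE)
  have q0: "q \<noteq> 0" using Suc.prems p by auto
  have "degree p = degree [:- \<mu>, 1:] + degree q"
    unfolding p by (rule degree_mult_eq) (use q0 in auto)
  then have dq: "d = degree q" using Suc.hyps(2) by simp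
  show ?case
  proof (cases "\<exists>y. y \<noteq> 0 \<and> A *v y = \<mu> *s y")
    case False
    have "A *v poly_op A q z = \<mu> *s poly_op A q z"
      using Suc.prems(2) unfolding p poly_op_linear_factor poly_op_diff_vec poly_op_commute by simp
    then have "poly_op A q z = 0" using False by blast
    then show ?thesis using Suc.hyps(1)[OF dq q0] by blast
  next
    case True
    then have mu: "cmod \<mu> < r" using eig by blast
    define y where "y = A *v z - \<mu> *s z"
    have "poly_op A q y = 0"
      using Suc.prems(2) unfolding p poly_op_linear_factor y_def .
    from Suc.hyps(1)[OF dq q0 this] obtain M
      where M: "\<And>k. norm (((*v) A ^^ k) y) \<le> M * r ^ k" by blast
    \<comment> \<open>\<open>A\<^sup>k\<^sup>+\<^sup>1 z = \<mu> A\<^sup>k z + A\<^sup>k y\<close>, and \<open>M' r\<^sup>k\<close> is a supersolution of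
      this recursion as soon as \<open>M' \<ge> M / (r - |\<mu>|)\<close>.\<close>
    define M' where "M' = max (norm z) (M / (r - cmod \<mu>))"
    have M': "M \<le> M' * (r - cmod \<mu>)"
      using mu by (simp add: M'_def flip: pos_divide_le_eq)
    have step: "((*v) A ^^ Suc k) z = \<mu> *s ((*v) A ^^ k) z + ((*v) A ^^ k) y" for k
      by (simp add: y_def vec.diff vec.scale flip: mat_pow_mult_vec)
         (simp add: mat_pow_mult_vec funpow_swap1)
    have "norm (((*v) A ^^ k) z) \<le> M' * r ^ k" for k
    proof (induction k)
      case 0
      then show ?case by (simp add: M'_def)
    next
      case (Suc k)
      have "norm (((*v) A ^^ Suc k) z)
          \<le> cmod \<mu> * norm (((*v) A ^^ k) z) + norm (((*v) A ^^ k) y)"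
        unfolding step by (metis norm_triangle_ineq norm_vector_smult)
      also have "\<dots> \<le> cmod \<mu> * (M' * r ^ k) + M * r ^ k"
        using Suc M by (intro add_mono mult_left_mono) auto
      also have "\<dots> \<le> cmod \<mu> * (M' * r ^ k) + (M' * (r - cmod \<mu>)) * r ^ k"
        using M' mu by (intro add_left_mono mult_right_mono zero_le_power) (auto intro: order_trans[OF norm_ge_zero less_imp_le])
      also have "\<dots> = M' * r ^ Suc k" by (simp add: algebra_simps)
      finally show ?case .
    qed
    then show ?thesis by blast
  qed
qed

text \<open>The set of eigenvalue moduli has to be shown finite and nonempty before \<^const>\<open>Max\<close> means
  anything.\<close>

lemma spectral_radius_facts:
  fixes A :: "real^'n^'n"
  defines "Ac \<equiv> map_matrix complex_of_real A"
  shows eigenvalue_le_spectral_radius: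
      "\<And>z \<mu>. z \<noteq> 0 \<Longrightarrow> Ac *v z = \<mu> *s z \<Longrightarrow> cmod \<mu> \<le> spectral_radius A"
    and spectral_radius_nonneg: "0 \<le> spectral_radius A"
proof -
  define E where "E = {\<mu>. \<exists>z. z \<noteq> 0 \<and> Ac *v z = \<mu> *s z}"
  obtain p where p: "p \<noteq> 0" "\<And>z. poly_op Ac p z = 0"
    using annihilating_poly by blast
  have "E \<subseteq> {\<mu>. poly p \<mu> = 0}"
  proof
    fix \<mu> assume "\<mu> \<in> E"
    then obtain z where z: "z \<noteq> 0" "Ac *v z = \<mu> *s z" by (auto simp: E_def)
    then have "poly p \<mu> *s z = 0"
      using poly_op_eigenvector[OF z(2), of p] p(2) by simp
    with z show "\<mu> \<in> {\<mu>. poly p \<mu> = 0}" by simp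
  qed
  then have fin: "finite E"
    using poly_roots_finite[OF p(1)] finite_subset by blast
  have rad: "spectral_radius A = Max (cmod ` E)"
    unfolding spectral_radius_def E_def Ac_def by (rule arg_cong[of _ _ Max]) auto
  show le: "cmod \<mu> \<le> spectral_radius A" if "z \<noteq> 0" "Ac *v z = \<mu> *s z" for z \<mu>
    unfolding rad using that fin by (intro Max_ge) (auto simp: E_def)
  have "E \<noteq> {}"
  proof
    assume "E = {}"
    \<comment> \<open>Without eigenvalues the power bound holds even for \<open>r = 0\<close>, hence \<open>A = 0\<close>.\<close>
    then have none: "cmod \<mu> < 0" if "z \<noteq> 0" "Ac *v z = \<mu> *s z" for \<mu> z
      using that \<open>E = {}\<close> unfolding E_def by blast
    have "Ac *v z = 0 *s z" for z
    proof -
      obtain M where "\<And>k. norm (((*v) Ac ^^ k) z) \<le> M * 0 ^ k"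
        using power_bound_of_annihilated[of Ac 0 p z] none p by blast
      from this[of 1] show ?thesis by simp
    qed
    moreover obtain z :: "complex^'n" where "z \<noteq> 0"
      using UNIV_not_singleton by blast
    ultimately show False using none[of z 0] by simp
  qed
  then obtain \<mu> z where "z \<noteq> 0" "Ac *v z = \<mu> *s z" by (auto simp: E_def)
  from le[OF this] show "0 \<le> spectral_radius A"
    using norm_ge_zero order_trans by blast
qed

section \<open>Real matrices through complexification\<close>

definition cvec :: "real^'n \<Rightarrow> complex^'n" where
  "cvec x = (\<chi> i. complex_of_real (x $ i))"

lemma norm_cvec [simp]: "norm (cvec x) = norm x"
  by (simp add: norm_vec_def cvec_def)

lemma cvec_mult: "map_matrix complex_of_real A *v cvec x = cvec (A *v x)"
  by (simp add: vec_eq_iff matrix_vector_mult_def cvec_def map_matrix_def)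

text \<open>Complexification gives each vector a bound of its own; expansion in the finite basis
  makes the constant uniform.\<close>

lemma power_bound:
  fixes A :: "real^'n^'n"
  assumes "spectral_radius A < r"
  obtains M where "M \<ge> 1" "\<And>k x. norm (((*v) A ^^ k) x) \<le> M * r ^ k * norm x"
proof -
  have r: "0 \<le> r" using spectral_radius_nonneg[of A] assms by simp
  have "\<exists>M. \<forall>k. norm (((*v) A ^^ k) x) \<le> M * r ^ k" for x
  proof -
    let ?Ac = "map_matrix complex_of_real A"
    obtain p where p: "p \<noteq> 0" "\<And>z. poly_op ?Ac p z = 0"
      using annihilating_poly by blast
    have "cmod \<mu> < r" if "z \<noteq> 0" "?Ac *v z = \<mu> *s z" for \<mu> z
      using eigenvalue_le_spectral_radius[OF that] assms by simp
    then obtain M where M: "\<And>k. norm (((*v) ?Ac ^^ k) (cvec x)) \<le> M * r ^ k"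
      using power_bound_of_annihilated[of ?Ac r p "cvec x"] p by blast
    have "((*v) ?Ac ^^ k) (cvec x) = cvec (((*v) A ^^ k) x)" for k
      by (induction k) (simp_all add: cvec_mult)
    then show ?thesis using M by (metis norm_cvec)
  qed
  then obtain m where m: "\<And>x k. norm (((*v) A ^^ k) x) \<le> m x * r ^ k" by metis
  define M where "M = (\<Sum>b\<in>Basis. \<bar>m b\<bar>) + 1"
  show thesis
  proof
    show "1 \<le> M" by (simp add: M_def sum_nonneg)
    fix k x
    have "((*v) A ^^ k) x = mat_pow A k *v (\<Sum>b\<in>Basis. (x \<bullet> b) *\<^sub>R b)"
      by (simp add: mat_pow_mult_vec euclidean_representation)
    also have "\<dots> = (\<Sum>b\<in>Basis. (x \<bullet> b) *\<^sub>R ((*v) A ^^ k) b)"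
      by (simp add: linear_sum linear_scale flip: mat_pow_mult_vec)
    also have "norm \<dots> \<le> (\<Sum>b\<in>Basis. norm x * (\<bar>m b\<bar> * r ^ k))"
    proof (rule sum_norm_le)
      fix b :: "real^'n" assume b: "b \<in> Basis"
      have "norm (((*v) A ^^ k) b) \<le> \<bar>m b\<bar> * r ^ k"
        using m[of k b] r by (meson abs_ge_self mult_right_mono order_trans zero_le_power)
      then show "norm ((x \<bullet> b) *\<^sub>R ((*v) A ^^ k) b) \<le> norm x * (\<bar>m b\<bar> * r ^ k)"
        using Basis_le_norm[OF b, of x] by (auto intro!: mult_mono)
    qed
    also have "\<dots> = (M - 1) * r ^ k * norm x"
      by (simp add: M_def sum_distrib_left sum_distrib_right mult_ac)
    also have "\<dots> \<le> M * r ^ k * norm x"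
      using r by (intro mult_right_mono) auto
    finally show "norm (((*v) A ^^ k) x) \<le> M * r ^ k * norm x" .
  qed
qed

text \<open>A fixed point of A equals all its iterates, which tend to 0 by the power bound with some
  r < 1; thus 1 - A is injective.\<close>

lemma invertible_one_minus:
  fixes A :: "real^'n^'n"
  assumes "spectral_radius A < 1"
  shows "invertible (mat 1 - A)"
proof -
  obtain r where r: "spectral_radius A < r" "r < 1" using dense assms by blast
  then have r0: "0 \<le> r" using spectral_radius_nonneg[of A] by simp
  obtain M where M: "\<And>k x. norm (((*v) A ^^ k) x) \<le> M * r ^ k * norm x"
    using power_bound[OF r(1)] by metis
  have "x = 0" if "(mat 1 - A) *v x = 0" for x
  proof -
    have "A *v x = x" using that by (simp add: matrix_vector_mult_diff_rdistrib)
    then have "((*v) A ^^ k) x = x" for k by (induction k) simp_all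
    then have le: "norm x \<le> M * r ^ k * norm x" for k using M by metis
    have "(\<lambda>k. M * r ^ k * norm x) \<longlonglongrightarrow> M * 0 * norm x"
      using r r0 by (intro tendsto_intros LIMSEQ_power_zero) auto
    then have "norm x \<le> M * 0 * norm x"
      using le by (meson LIMSEQ_le_const)
    then show ?thesis by simp
  qed
  then have "inj ((*v) (mat 1 - A))"
    by (metis (no_types, lifting) linear_injective_0 matrix_vector_mul_linear)
  then show ?thesis
    by (simp add: invertible_left_inverse matrix_left_invertible_injective)
qed

section \<open>Projected gradient steps\<close>

text \<open>Applied after an inequality along a segment has been divided by the parameter s: the
  error of order s disappears in the limit.\<close>

lemma le_of_le_add_small:
  fixes a b c :: real
  assumes "\<And>s. 0 < s \<Longrightarrow> s \<le> 1 \<Longrightarrow> a \<le> b + s * c"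
  shows "a \<le> b"
proof (rule tendsto_lowerbound)
  show "((\<lambda>s. b + s * c) \<longlongrightarrow> b) (at_right 0)"
    by (auto intro!: tendsto_eq_intros)
  show "\<forall>\<^sub>F s in at_right 0. a \<le> b + s * c"
    using assms by (auto simp: eventually_at_right_field intro: exI[of _ 1])
qed simp

text \<open>The gradient is a parameter \<open>g\<close> and not \<open>grad f\<close>, because
  differentiability is known only relative to S; \<open>grad_eqI\<close> reconciles the two at
  interior points.\<close>

locale smooth_strongly_convex =
  fixes S :: "'a::real_inner set" and f :: "'a \<Rightarrow> real" and g :: "'a \<Rightarrow> 'a" and \<alpha> l :: real
  assumes convex: "convex S"
    and deriv: "\<And>x. x \<in> S \<Longrightarrow> (f has_derivative (\<lambda>h. g x \<bullet> h)) (at x within S)"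
    and lip: "l-lipschitz_on S g"
    and sconvex: "strongly_convex_on \<alpha> S f"
    and pos: "\<alpha> > 0" "l > 0"
begin

text \<open>The sign c yields the upper and the lower bound at once. By the mean value theorem for
  the defect \<phi> along the segment it is enough that its derivative is nonpositive, which is the
  Lipschitz bound on g.\<close>

lemma quadratic_bound_aux:
  assumes "x \<in> S" "y \<in> S" "c = 1 \<or> c = - 1"
  shows "c * (f y - f x - g x \<bullet> (y - x)) \<le> l / 2 * (norm (y - x))\<^sup>2"
proof -
  define d where "d = y - x"
  define \<gamma> where "\<gamma> s = x + s *\<^sub>R d" for s
  have \<gamma>: "\<gamma> s \<in> S" if "0 \<le> s" "s \<le> 1" for s
    using convexD_alt[OF convex assms(1,2) that] by (simp add: \<gamma>_def d_def algebra_simps)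
  define \<phi> where "\<phi> s = c * f (\<gamma> s) - c * s * (g x \<bullet> d) - l / 2 * s\<^sup>2 * (norm d)\<^sup>2" for s
  define \<phi>' where "\<phi>' s h = (c * (g (\<gamma> s) \<bullet> d) - c * (g x \<bullet> d) - l * s * (norm d)\<^sup>2) * h" for s h
  have der: "(\<phi> has_derivative \<phi>' s) (at s within {0..1})" if s: "0 \<le> s" "s \<le> 1" for s
  proof -
    have "(\<gamma> has_derivative (\<lambda>h. h *\<^sub>R d)) (at s within {0..1})"
      unfolding \<gamma>_def by (auto intro!: derivative_eq_intros)
    moreover have "(f has_derivative (\<lambda>h. g (\<gamma> s) \<bullet> h)) (at (\<gamma> s) within \<gamma> ` {0..1})"
      using deriv[OF \<gamma>[OF s]] by (rule has_derivative_subset) (auto intro: \<gamma>)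
    ultimately have "((\<lambda>s. f (\<gamma> s)) has_derivative (\<lambda>h. g (\<gamma> s) \<bullet> (h *\<^sub>R d))) (at s within {0..1})"
      using has_derivative_in_compose by blast
    then show ?thesis
      unfolding \<phi>_def \<phi>'_def
      by (auto intro!: derivative_eq_intros simp: algebra_simps power2_eq_square)
  qed
  obtain s where s: "0 < s" "s < 1" "\<phi> 1 - \<phi> 0 = \<phi>' s 1"
    using mvt_simple[of 0 1 \<phi> \<phi>'] der by auto
  have "c * ((g (\<gamma> s) - g x) \<bullet> d) \<le> \<bar>(g (\<gamma> s) - g x) \<bullet> d\<bar>"
    using assms(3) by auto
  also have "\<dots> \<le> norm (g (\<gamma> s) - g x) * norm d"
    by (rule Cauchy_Schwarz_ineq2)
  also have "\<dots> \<le> (l * norm (\<gamma> s - x)) * norm d"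
    using lipschitz_onD[OF lip \<gamma> assms(1), of s] s by (intro mult_right_mono) (auto simp: dist_norm)
  also have "\<dots> = l * s * (norm d)\<^sup>2"
    using s by (simp add: \<gamma>_def power2_eq_square)
  finally have "\<phi>' s 1 \<le> 0" by (simp add: \<phi>'_def inner_diff_left algebra_simps)
  with s(3) show ?thesis by (simp add: \<phi>_def \<gamma>_def d_def algebra_simps)
qed

lemma quadratic_bound:
  assumes "x \<in> S" "y \<in> S"
  shows "f y - f x - g x \<bullet> (y - x) \<le> l / 2 * (norm (y - x))\<^sup>2"
    and "g x \<bullet> (y - x) - (f y - f x) \<le> l / 2 * (norm (y - x))\<^sup>2"
  using quadratic_bound_aux[OF assms, of 1] quadratic_bound_aux[OF assms, of "- 1"] by auto

text \<open>At the point a fraction s towards y, strong convexity bounds f from above and the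
  quadratic bound from below; division by s and s tending to 0 leave the claim.\<close>

lemma first_order:
  assumes x: "x \<in> S" and y: "y \<in> S"
  shows "f x + g x \<bullet> (y - x) + \<alpha> / 2 * (norm (y - x))\<^sup>2 \<le> f y"
proof -
  let ?d = "(norm (y - x))\<^sup>2"
  have "g x \<bullet> (y - x) + \<alpha> / 2 * ?d \<le> f y - f x"
  proof (rule le_of_le_add_small)
    fix s :: real assume s: "0 < s" "s \<le> 1"
    let ?z = "(1 - s) *\<^sub>R x + s *\<^sub>R y"
    have z: "?z - x = s *\<^sub>R (y - x)" by (simp add: algebra_simps)
    have zS: "?z \<in> S" using convexD_alt[OF convex x y] s by simp
    have "s * (g x \<bullet> (y - x)) - l / 2 * (s\<^sup>2 * ?d) \<le> f ?z - f x"
      using quadratic_bound(2)[OF x zS] unfolding z by (simp add: power_mult_distrib)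
    also have "f ?z \<le> (1 - s) * f x + s * f y - \<alpha> / 2 * s * (1 - s) * ?d"
      using sconvex x y s unfolding strongly_convex_on_def by (simp add: norm_minus_commute)
    finally have "s * (g x \<bullet> (y - x) + \<alpha> / 2 * ?d) \<le> s * (f y - f x + s * (\<alpha> / 2 * ?d + l / 2 * ?d))"
      by (simp add: field_simps power2_eq_square)
    then show "g x \<bullet> (y - x) + \<alpha> / 2 * ?d \<le> f y - f x + s * (\<alpha> / 2 * ?d + l / 2 * ?d)"
      using s by simp
  qed
  then show ?thesis by simp
qed

lemma strong_monotone:
  assumes "x \<in> S" "y \<in> S"
  shows "\<alpha> * (norm (x - y))\<^sup>2 \<le> (g x - g y) \<bullet> (x - y)"
  using first_order[OF assms] first_order[OF assms(2,1)]
  by (simp add: norm_minus_commute inner_diff_left inner_diff_right)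

text \<open>The usual proof of cocoercivity leaves the segment from \<open>x\<close> to \<open>y\<close>; the ball around \<open>y\<close>
  keeps the auxiliary point inside \<open>S\<close>, where alone the gradient is controlled.\<close>

lemma cocoercive_aux:
  assumes x: "x \<in> S" and ball: "cball y \<delta> \<subseteq> S" and near: "dist x y \<le> \<delta>"
  shows "f x + g x \<bullet> (y - x) + (norm (g y - g x))\<^sup>2 / (2 * l) \<le> f y"
proof -
  define D where "D = g y - g x"
  \<comment> \<open>The minimizer of the quadratic upper model at y of f minus the linear function
    with slope g x. The assumption \<open>near\<close> keeps it in the ball.\<close>
  define z where "z = y - (1 / l) *\<^sub>R D"
  have "0 \<le> \<delta>" using near zero_le_dist order_trans by blast
  then have y: "y \<in> S" using ball by auto
  have "norm D \<le> l * dist x y"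
    using lipschitz_onD[OF lip y x] by (simp add: D_def dist_norm norm_minus_commute)
  also have "\<dots> \<le> l * \<delta>" using near pos by simp
  finally have "dist y z \<le> \<delta>" using pos by (simp add: z_def dist_norm field_simps)
  then have z: "z \<in> S" using ball by auto
  have "f x + g x \<bullet> (z - x) \<le> f z"
    using first_order[OF x z] pos zero_le_power2[of "norm (z - x)"]
    by (smt (verit) divide_nonneg_nonneg mult_nonneg_nonneg)
  also have "f z \<le> f y + g y \<bullet> (z - y) + l / 2 * (norm (z - y))\<^sup>2"
    using quadratic_bound(1)[OF y z] by simp
  finally have "f x + g x \<bullet> (z - x) \<le> f y + g y \<bullet> (z - y) + l / 2 * (norm (z - y))\<^sup>2" .
  moreover have "l / 2 * (norm (z - y))\<^sup>2 = (norm D)\<^sup>2 / (2 * l)"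
    using pos by (simp add: z_def power_divide power2_eq_square)
  moreover have "g x \<bullet> (z - x) = g x \<bullet> (y - x) - (g x \<bullet> D) / l"
    by (simp add: z_def inner_diff_right algebra_simps)
  moreover have "g y \<bullet> (z - y) = - (g y \<bullet> D) / l"
    by (simp add: z_def)
  moreover have "(g y \<bullet> D) / l - (g x \<bullet> D) / l = (norm D)\<^sup>2 / l"
    by (simp add: D_def power2_norm_eq_inner inner_diff_left flip: diff_divide_distrib)
  ultimately show ?thesis
    by (simp add: D_def field_simps)
qed

lemma cocoercive:
  assumes "cball x \<delta> \<subseteq> S" "cball y \<delta> \<subseteq> S" "dist x y \<le> \<delta>"
  shows "(norm (g x - g y))\<^sup>2 / l \<le> (g x - g y) \<bullet> (x - y)"
proof -
  have "0 \<le> \<delta>" using assms(3) zero_le_dist order_trans by blast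
  then have "x \<in> S" "y \<in> S" using assms by auto
  from cocoercive_aux[OF this(1) assms(2,3)] cocoercive_aux[OF this(2) assms(1)] assms(3)
  show ?thesis
    by (simp add: dist_commute norm_minus_commute inner_diff_left inner_diff_right field_simps)
qed

text \<open>The radicand is the factor for squared distances that cocoercivity and strong
  monotonicity give; \<open>max 0\<close> keeps it nonnegative without comparing \<alpha> with
  l.\<close>

definition contraction :: "real \<Rightarrow> real" where
  "contraction \<gamma> = sqrt (max 0 (1 - \<gamma> * (2 - \<gamma> * l) * \<alpha>))"

end

text \<open>A segment stays in the convex set and can be cut into pieces of length at most \<delta>,
  whose lengths add up to the whole distance.\<close>

lemma lipschitz_on_convex_of_local:
  fixes F :: "'a::real_normed_vector \<Rightarrow> 'b::metric_space"
  assumes "convex S" "\<delta> > 0" "0 \<le> q"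
    and loc: "\<And>x y. x \<in> S \<Longrightarrow> y \<in> S \<Longrightarrow> dist x y \<le> \<delta> \<Longrightarrow> dist (F x) (F y) \<le> q * dist x y"
  shows "q-lipschitz_on S F"
proof (rule lipschitz_onI)
  have *: "dist (F x) (F y) \<le> q * dist x y"
    if "dist x y \<le> real (Suc n) * \<delta>" "x \<in> S" "y \<in> S" for n x y
    using that
  proof (induction n arbitrary: x)
    case 0
    then show ?case using loc by simp
  next
    case (Suc n)
    \<comment> \<open>The first of n + 2 equal pieces is cut off: it has length at most \<delta>,
      and the rest is short enough for the induction hypothesis.\<close>
    define s where "s = 1 / real (Suc (Suc n))"
    have s: "0 < s" "s \<le> 1" "(1 - s) = s * real (Suc n)" "s * real (Suc (Suc n)) = 1"
      by (auto simp: s_def field_simps)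
    define z where "z = (1 - s) *\<^sub>R x + s *\<^sub>R y"
    have z: "z \<in> S"
      unfolding z_def using s by (intro convexD_alt[OF assms(1) Suc.prems(2,3)]) auto
    have "x - z = s *\<^sub>R (x - y)" "z - y = (1 - s) *\<^sub>R (x - y)"
      by (simp_all add: z_def algebra_simps)
    then have d: "dist x z = s * dist x y" "dist z y = (1 - s) * dist x y"
      using s by (simp_all add: dist_norm)
    have "s * dist x y \<le> s * (real (Suc (Suc n)) * \<delta>)"
      using Suc.prems s by (intro mult_left_mono) auto
    also have "\<dots> = \<delta>" using s(4) by (simp add: mult.assoc[symmetric] del: of_nat_Suc)
    finally have sd: "s * dist x y \<le> \<delta>" .
    have 1: "dist (F x) (F z) \<le> q * dist x z"
      using loc[OF Suc.prems(2) z] sd d by simp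
    have "(1 - s) * dist x y \<le> real (Suc n) * \<delta>"
      using mult_left_mono[OF sd, of "real (Suc n)"] unfolding s(3) by (simp add: mult_ac)
    then have 2: "dist (F z) (F y) \<le> q * dist z y"
      using Suc.IH[OF _ z Suc.prems(3)] d by simp
    have "dist (F x) (F y) \<le> q * dist x z + q * dist z y"
      using 1 2 dist_triangle[of "F x" "F y" "F z"] by simp
    also have "\<dots> = q * dist x y" by (simp add: d algebra_simps)
    finally show ?case .
  qed
  fix x y assume "x \<in> S" "y \<in> S"
  moreover obtain n where "dist x y / \<delta> \<le> real n" using real_arch_simple by blast
  then have "dist x y \<le> real (Suc n) * \<delta>"
    using \<open>\<delta> > 0\<close> by (simp add: field_simps)
  ultimately show "dist (F x) (F y) \<le> q * dist x y" using * by blast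
qed fact

context smooth_strongly_convex
begin

text \<open>Cocoercivity is available only at distance at most \<delta>, whence the passage from
  local to global. In the expanded square it absorbs the term quadratic in \<gamma>; as \<gamma> l
  \<le> 2, strong monotonicity bounds what remains.\<close>

lemma gradient_step_lipschitz:
  assumes S': "convex S'" and \<delta>: "\<delta> > 0" "\<And>x. x \<in> S' \<Longrightarrow> cball x \<delta> \<subseteq> S"
    and \<gamma>: "0 \<le> \<gamma>" "\<gamma> * l \<le> 2"
  shows "(contraction \<gamma>)-lipschitz_on S' (\<lambda>x. x - \<gamma> *\<^sub>R g x)"
proof (rule lipschitz_on_convex_of_local[OF S' \<delta>(1)])
  show "0 \<le> contraction \<gamma>" by (simp add: contraction_def)
  fix x y assume xy: "x \<in> S'" "y \<in> S'" "dist x y \<le> \<delta>"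
  define D where "D = g x - g y"
  define X where "X = x - y"
  have inS: "x \<in> S" "y \<in> S" using xy(1,2) \<delta> centre_in_cball less_imp_le by blast+
  have co: "(norm D)\<^sup>2 \<le> l * (D \<bullet> X)"
    using cocoercive[OF \<delta>(2)[OF xy(1)] \<delta>(2)[OF xy(2)] xy(3)] pos
    by (simp add: D_def X_def field_simps)
  have mono: "\<alpha> * (norm X)\<^sup>2 \<le> D \<bullet> X"
    using strong_monotone[OF inS] by (simp add: D_def X_def)
  have "(norm (X - \<gamma> *\<^sub>R D))\<^sup>2 = (norm X)\<^sup>2 - 2 * \<gamma> * (D \<bullet> X) + \<gamma>\<^sup>2 * (norm D)\<^sup>2"
    unfolding power2_norm_eq_inner
    by (simp add: inner_diff_left inner_diff_right inner_commute power2_eq_square algebra_simps)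
  also have "\<dots> \<le> (norm X)\<^sup>2 - 2 * \<gamma> * (D \<bullet> X) + \<gamma>\<^sup>2 * (l * (D \<bullet> X))"
    using co by (intro add_left_mono mult_left_mono) auto
  also have "\<dots> = (norm X)\<^sup>2 - \<gamma> * (2 - \<gamma> * l) * (D \<bullet> X)"
    by (simp add: algebra_simps power2_eq_square)
  also have "\<dots> \<le> (norm X)\<^sup>2 - \<gamma> * (2 - \<gamma> * l) * (\<alpha> * (norm X)\<^sup>2)"
    using mono \<gamma> by (intro diff_left_mono mult_left_mono) auto
  also have "\<dots> = (1 - \<gamma> * (2 - \<gamma> * l) * \<alpha>) * (norm X)\<^sup>2"
    by (simp add: algebra_simps)
  also have "\<dots> \<le> max 0 (1 - \<gamma> * (2 - \<gamma> * l) * \<alpha>) * (norm X)\<^sup>2"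
    by (intro mult_right_mono) auto
  also have "\<dots> = (contraction \<gamma> * norm X)\<^sup>2"
    by (simp add: contraction_def power_mult_distrib)
  finally have "norm (X - \<gamma> *\<^sub>R D) \<le> contraction \<gamma> * norm X"
    by (rule power2_le_imp_le) (simp add: contraction_def)
  moreover have "x - \<gamma> *\<^sub>R g x - (y - \<gamma> *\<^sub>R g y) = X - \<gamma> *\<^sub>R D"
    by (simp add: X_def D_def algebra_simps)
  ultimately show "dist (x - \<gamma> *\<^sub>R g x) (y - \<gamma> *\<^sub>R g y) \<le> contraction \<gamma> * dist x y"
    unfolding dist_norm by (simp only: X_def)
qed

text \<open>Moving from \<eta> a fraction s towards z cannot lower f; the quadratic bound turns this
  into a statement on g \<eta> with an error that is of order s after division by s.\<close>

lemma minimizer_variational: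
  assumes S': "convex S'" "S' \<subseteq> S" and \<eta>: "\<eta> \<in> S'" "\<And>z. z \<in> S' \<Longrightarrow> f \<eta> \<le> f z" and z: "z \<in> S'"
  shows "0 \<le> g \<eta> \<bullet> (z - \<eta>)"
proof (rule le_of_le_add_small)
  fix s :: real assume s: "0 < s" "s \<le> 1"
  let ?y = "(1 - s) *\<^sub>R \<eta> + s *\<^sub>R z"
  have y: "?y \<in> S'" using convexD_alt[OF S'(1) \<eta>(1) z] s by simp
  have d: "?y - \<eta> = s *\<^sub>R (z - \<eta>)" by (simp add: algebra_simps)
  have "f ?y - f \<eta> - s * (g \<eta> \<bullet> (z - \<eta>)) \<le> l / 2 * (s\<^sup>2 * (norm (z - \<eta>))\<^sup>2)"
    using quadratic_bound(1)[of \<eta> ?y] \<eta>(1) y S'(2) unfolding d by (auto simp: power_mult_distrib)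
  then have "s * 0 \<le> s * (g \<eta> \<bullet> (z - \<eta>) + s * (l / 2 * (norm (z - \<eta>))\<^sup>2))"
    using \<eta>(2)[OF y] by (simp add: algebra_simps power2_eq_square)
  then show "0 \<le> g \<eta> \<bullet> (z - \<eta>) + s * (l / 2 * (norm (z - \<eta>))\<^sup>2)"
    using s by (simp only: mult_le_cancel_left_pos)
qed

end

text \<open>By its variational inequality the minimizer is a fixed point of the projected step. The
  projection is nonexpansive, so the factor of the plain gradient step carries over.\<close>

lemma projected_gradient_contraction:
  fixes S' :: "'a::euclidean_space set"
  assumes "smooth_strongly_convex S f g \<alpha> l"
    and S': "convex S'" "closed S'" and \<delta>: "\<delta> > 0" "\<And>x. x \<in> S' \<Longrightarrow> cball x \<delta> \<subseteq> S"
    and \<gamma>: "0 < \<gamma>" "\<gamma> * l \<le> 2"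
    and \<eta>: "\<eta> \<in> S'" "\<And>z. z \<in> S' \<Longrightarrow> f \<eta> \<le> f z" and r: "r \<in> S'"
  shows "norm (closest_point S' (r - \<gamma> *\<^sub>R g r) - \<eta>)
    \<le> sqrt (max 0 (1 - \<gamma> * (2 - \<gamma> * l) * \<alpha>)) * norm (r - \<eta>)"
proof -
  interpret smooth_strongly_convex S f g \<alpha> l by fact
  have sub: "S' \<subseteq> S" using \<delta> by force
  have fix_pt: "\<eta> = closest_point S' (\<eta> - \<gamma> *\<^sub>R g \<eta>)"
  proof (rule closest_point_unique[OF S' \<eta>(1)], intro ballI)
    fix z assume z: "z \<in> S'"
    have "(norm (\<gamma> *\<^sub>R g \<eta>))\<^sup>2 \<le> (norm (\<gamma> *\<^sub>R g \<eta>))\<^sup>2 + 2 * \<gamma> * (g \<eta> \<bullet> (z - \<eta>)) + (norm (z - \<eta>))\<^sup>2"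
      using minimizer_variational[OF S'(1) sub \<eta> z] \<gamma> by simp
    also have "\<dots> = (norm (\<gamma> *\<^sub>R g \<eta> + (z - \<eta>)))\<^sup>2"
      unfolding power2_norm_eq_inner
      by (simp add: inner_add_left inner_add_right inner_commute)
    finally have "norm (\<gamma> *\<^sub>R g \<eta>) \<le> norm (\<gamma> *\<^sub>R g \<eta> + (z - \<eta>))"
      by (rule power2_le_imp_le) simp
    then show "dist (\<eta> - \<gamma> *\<^sub>R g \<eta>) \<eta> \<le> dist (\<eta> - \<gamma> *\<^sub>R g \<eta>) z"
      by (metis (no_types, opaque_lifting) add.commute diff_add_cancel diff_diff_eq2 dist_commute dist_norm)
  qed
  have "dist (closest_point S' (r - \<gamma> *\<^sub>R g r)) \<eta> \<le> dist (r - \<gamma> *\<^sub>R g r) (\<eta> - \<gamma> *\<^sub>R g \<eta>)"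
    using closest_point_lipschitz[OF S', of "r - \<gamma> *\<^sub>R g r" "\<eta> - \<gamma> *\<^sub>R g \<eta>"] r
    unfolding fix_pt[symmetric] by auto
  also have "\<dots> \<le> contraction \<gamma> * dist r \<eta>"
    using lipschitz_onD[OF gradient_step_lipschitz[OF S'(1) \<delta>] r \<eta>(1)] \<gamma> by simp
  finally show ?thesis by (simp add: dist_norm contraction_def)
qed

text \<open>At an interior point the relative derivative is a full one and hence unique, as the
  definite description in \<open>grad\<close> requires.\<close>

lemma grad_eqI:
  assumes "(f has_derivative (\<lambda>h. g \<bullet> h)) (at x within S)" "x \<in> interior S"
  shows "grad f x = g"
proof -
  have "(f has_derivative (\<lambda>h. g \<bullet> h)) (at x)"
    using assms at_within_interior by metis
  then have *: "GDERIV f x :> g"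
    by (simp add: gderiv_def inner_commute)
  show ?thesis
    unfolding grad_def
  proof (rule the_equality)
    show "GDERIV f x :> g" by fact
    fix g' assume "GDERIV f x :> g'"
    with * have "(\<lambda>h. h \<bullet> g') = (\<lambda>h. h \<bullet> g)"
      unfolding gderiv_def using has_derivative_unique by blast
    then have "\<And>h. h \<bullet> (g' - g) = 0"
      by (metis inner_diff_right right_minus_eq)
    then show "g' = g" by (metis inner_eq_zero_iff right_minus_eq)
  qed
qed

text \<open>At the midpoint strong convexity forces a drop below the mean of the end values that is
  quadratic in the distance, while the Lipschitz bound allows only a linear one.\<close>

lemma strongly_convex_lipschitz_dist_le:
  assumes sc: "strongly_convex_on \<alpha> S f" and lip: "\<Lambda>-lipschitz_on S f" and "convex S" "\<alpha> > 0"
    and x: "x \<in> S" and y: "y \<in> S"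
  shows "norm (x - y) \<le> 4 * \<Lambda> / \<alpha>"
proof -
  define m where "m = (1 - 1 / 2) *\<^sub>R x + (1 / 2 :: real) *\<^sub>R y"
  have m: "m \<in> S" using convexD_alt[OF \<open>convex S\<close> x y, of "1/2"] by (simp add: m_def)
  have "x - m = (1 / 2) *\<^sub>R (x - y)" "y - m = - (1 / 2) *\<^sub>R (x - y)"
    by (simp_all add: m_def algebra_simps flip: scaleR_add_left)
  then have d: "dist x m = norm (x - y) / 2" "dist y m = norm (x - y) / 2"
    by (simp_all add: dist_norm)
  have "f m \<le> (1 - 1/2) * f x + 1/2 * f y - \<alpha> / 2 * (1/2) * (1 - 1/2) * (norm (x - y))\<^sup>2"
    using sc x y unfolding strongly_convex_on_def m_def by fastforce
  then have "\<alpha> / 8 * (norm (x - y))\<^sup>2 \<le> (f x - f m) / 2 + (f y - f m) / 2"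
    by (simp add: field_simps)
  also have "\<dots> \<le> \<Lambda> * (norm (x - y) / 2)"
  proof -
    have "f x - f m \<le> \<Lambda> * (norm (x - y) / 2)" "f y - f m \<le> \<Lambda> * (norm (x - y) / 2)"
      using lipschitz_onD[OF lip x m] lipschitz_onD[OF lip y m]
      unfolding d dist_real_def by (simp_all only: abs_le_iff)
    moreover have "(f x - f m) / 2 + (f y - f m) / 2 \<le> B" if "f x - f m \<le> B" "f y - f m \<le> B" for B
      using that by argo
    ultimately show ?thesis by blast
  qed
  finally have *: "norm (x - y) * (\<alpha> * norm (x - y)) \<le> norm (x - y) * (4 * \<Lambda>)"
    by (simp add: power2_eq_square algebra_simps)
  have "0 \<le> \<Lambda>" using lip lipschitz_on_nonneg by blast
  show ?thesis
  proof (cases "norm (x - y) = 0")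
    case True
    then show ?thesis using \<open>0 \<le> \<Lambda>\<close> \<open>\<alpha> > 0\<close> by simp
  next
    case False
    then have "0 < norm (x - y)" by simp
    from mult_left_le_imp_le[OF * this] show ?thesis
      using \<open>\<alpha> > 0\<close> by (simp add: field_simps)
  qed
qed

text \<open>After summation the same sum stands on both sides, and its part with factor q < 1 is
  moved to the left.\<close>

lemma sum_linear_recursion_le:
  fixes a b :: "nat \<Rightarrow> real"
  assumes q: "q < 1" and "\<And>t. 0 \<le> a t" and rec: "\<And>t. a (Suc t) \<le> q * a t + b t" and "0 \<le> q"
  shows "(\<Sum>t\<le>T. a t) \<le> (a 0 + (\<Sum>t<T. b t)) / (1 - q)"
proof -
  have "(\<Sum>t\<le>T. a t) \<le> q * (\<Sum>t\<le>T. a t) + (a 0 + (\<Sum>t<T. b t))"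
  proof -
    have "(\<Sum>t\<le>T. a t) = a 0 + (\<Sum>t<T. a (Suc t))"
      by (metis lessThan_Suc_atMost sum.lessThan_Suc_shift)
    also have "\<dots> \<le> a 0 + (\<Sum>t<T. q * a t + b t)"
      using rec by (intro add_left_mono sum_mono)
    also have "\<dots> = a 0 + (q * (\<Sum>t<T. a t) + (\<Sum>t<T. b t))"
      by (simp add: sum.distrib sum_distrib_left)
    also have "\<dots> \<le> a 0 + (q * (\<Sum>t\<le>T. a t) + (\<Sum>t<T. b t))"
      using assms by (intro add_left_mono add_right_mono mult_left_mono sum_mono2) auto
    finally show ?thesis by simp
  qed
  then have "(1 - q) * (\<Sum>t\<le>T. a t) \<le> a 0 + (\<Sum>t<T. b t)" by (simp add: algebra_simps)
  then show ?thesis using q by (simp add: field_simps)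
qed

section \<open>Invariance and margins of the admissible set\<close>

lemma norm_matrix_vector_le: "norm (A *v x) \<le> onorm ((*v) A) * norm (x :: real^'n)"
  for A :: "real^'n^'m"
  by (intro onorm matrix_vector_mul_bounded_linear)

lemma onorm_matrix_nonneg: "0 \<le> onorm ((*v) A)" for A :: "real^'n^'m"
  by (intro onorm_pos_le matrix_vector_mul_bounded_linear)

lemma continuous_on_matrix_vector [continuous_intros]:
  "continuous_on S f \<Longrightarrow> continuous_on S (\<lambda>x. A *v f x)" for A :: "real^'n^'m"
  by (rule bounded_linear.continuous_on[OF matrix_vector_mul_bounded_linear])

locale governed_system =
  fixes \<Sigma> :: "('n::finite, 'm::finite, 'o::finite, 'p::finite) control_system"
    and Y Ybar :: "(real^'p) set" and W :: "(real^'o) set" and P :: "(real^'n) set"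
    and lam :: real
  assumes schur: "schur_stable (A_K \<Sigma>)"
    and Y: "compact Y" "convex Y"
    and W0: "0 \<in> W"
    and lam: "spectral_radius (A_K \<Sigma>) < lam" "lam < 1"
    and invariant: "robust_invariant \<Sigma> lam W P"
    and minimal: "min_robust_invariant \<Sigma> lam W \<subseteq> P"
    and Ybar: "compact Ybar" "convex Ybar" "Ybar \<subseteq> interior Y"
begin

abbreviation "A \<equiv> A_K \<Sigma>"
abbreviation "S \<equiv> S_K \<Sigma>"
abbreviation "K \<equiv> mat_K \<Sigma>"
abbreviation "Bw \<equiv> mat_Bw \<Sigma>"
abbreviation "err \<equiv> scaled_error \<Sigma> lam"
abbreviation "Omega \<equiv> max_output_admissible \<Sigma> lam Y W"
abbreviation "Sbar \<equiv> tightened_refs \<Sigma> Ybar W P"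
abbreviation "Sv \<equiv> steady_refs \<Sigma> Y W"
abbreviation "out \<omega> v \<epsilon> t \<equiv>
  C_K \<Sigma> *v err \<omega> \<epsilon> t + output_gain \<Sigma> *v v + mat_Dw \<Sigma> *v \<omega> t"

lemma lam_pos: "0 < lam"
  using spectral_radius_nonneg[of A] lam by simp

text \<open>Schur stability makes 1 - A invertible, so \<open>matrix_inv\<close> is a genuine
  inverse and S v the equilibrium for the constant reference v.\<close>

lemma S_K_fixed_point: "A *v (S *v v) + mat_B \<Sigma> *v v = S *v v"
proof -
  have "invertible (mat 1 - A)"
    using invertible_one_minus schur unfolding schur_stable_def by blast
  then have "(mat 1 - A) ** matrix_inv (mat 1 - A) = mat 1"
    unfolding invertible_def matrix_inv_def by (rule someI2_ex) blast
  then have "(mat 1 - A) *v (S *v v) = mat_B \<Sigma> *v v"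
    unfolding S_K_def by (metis matrix_vector_mul_assoc matrix_vector_mul_lid)
  then show ?thesis
    by (simp add: matrix_vector_mult_diff_rdistrib algebra_simps)
qed

section \<open>The scaled error dynamics and the invariant set\<close>

lemma err_decomp: "err \<omega> \<epsilon> t = (1 / lam) ^ t *\<^sub>R ((*v) A ^^ t) \<epsilon> + err \<omega> 0 t"
  by (induction t) (simp_all add: matrix_vector_right_distrib matrix_vector_mult_scaleR algebra_simps)

lemma err_affine:
  "err \<omega> ((1 - s) *\<^sub>R \<epsilon> + s *\<^sub>R \<epsilon>') t = (1 - s) *\<^sub>R err \<omega> \<epsilon> t + s *\<^sub>R err \<omega> \<epsilon>' t"
proof (induction t)
  case 0
  then show ?case by simp
next
  case (Suc t)
  define c where "c = 1 / lam"
  show ?case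
    unfolding scaled_error.simps Suc.IH c_def[symmetric]
    by (simp add: matrix_vector_right_distrib matrix_vector_mult_scaleR algebra_simps)
qed

lemma err_shift:
  "err \<omega> \<epsilon> (Suc t) = err (\<lambda>t. \<omega> (Suc t)) ((1 / lam) *\<^sub>R (A *v \<epsilon> + Bw *v \<omega> 0)) t"
  by (induction t) simp_all

lemma zero_in_P: "0 \<in> P"
proof -
  have "0 \<in> scaled_noise \<Sigma> lam W"
    using W0 unfolding scaled_noise_def by (intro image_eqI[of _ _ 0]) auto
  moreover have "(scaled_map \<Sigma> lam ^^ i) 0 = 0" for i
    by (induction i) (auto simp: scaled_map_def)
  ultimately have "0 \<in> (scaled_map \<Sigma> lam ^^ i) ` scaled_noise \<Sigma> lam W" for i
    by (metis imageI)
  then have "0 \<in> min_robust_invariant \<Sigma> lam W"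
    unfolding min_robust_invariant_def minkowski_series_def
    by (intro CollectI exI[of _ "\<lambda>_. 0"] conjI allI sums_zero)
  then show ?thesis using minimal by blast
qed

text \<open>Invariance keeps the pure disturbance response in P once it starts there; this is why
  tightening the outputs by C P covers every disturbance sequence.\<close>

lemma err_zero_in_P:
  assumes "\<And>t. \<omega> t \<in> W"
  shows "err \<omega> 0 t \<in> P"
proof (induction t)
  case 0
  then show ?case by (simp add: zero_in_P)
next
  case (Suc t)
  have "scaled_map \<Sigma> lam (err \<omega> 0 t) + (1 / lam) *\<^sub>R (Bw *v \<omega> t) \<in>
      scaled_map \<Sigma> lam ` P + scaled_noise \<Sigma> lam W"
    using Suc assms by (intro set_plus_intro) (auto simp: scaled_noise_def)
  then show ?case
    using invariant by (auto simp: robust_invariant_def scaled_map_def algebra_simps)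
qed

text \<open>A compact set inside an open one has positive distance from the complement.\<close>

lemma output_margin: "\<exists>d>0. \<forall>y\<in>Ybar. cball y d \<subseteq> Y"
proof -
  have "Ybar \<inter> - interior Y = {}" using Ybar(3) by blast
  from separate_compact_closed[OF Ybar(1) _ this]
  obtain d where d: "d > 0" "\<And>x y. x \<in> Ybar \<Longrightarrow> y \<in> - interior Y \<Longrightarrow> d \<le> dist x y"
    by (auto simp: closed_Compl)
  have "cball y (d / 2) \<subseteq> Y" if "y \<in> Ybar" for y
  proof
    fix z assume "z \<in> cball y (d / 2)"
    then have "dist y z < d" using d(1) by simp
    then have "z \<in> interior Y" using d(2)[OF that, of z] by force
    then show "z \<in> Y" using interior_subset by blast
  qed
  then show ?thesis using d(1) by (intro exI[of _ "d / 2"]) auto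
qed

section \<open>The reference sets and their margins\<close>

lemma Sbar_iff:
  "v \<in> Sbar \<longleftrightarrow> (\<forall>p\<in>P. \<forall>\<omega>\<in>W. output_gain \<Sigma> *v v + C_K \<Sigma> *v p + mat_Dw \<Sigma> *v \<omega> \<in> Ybar)"
  by (auto simp: tightened_refs_def pontryagin_diff_def)

lemma Sv_iff: "v \<in> Sv \<longleftrightarrow> (\<forall>\<omega>\<in>W. output_gain \<Sigma> *v v + mat_Dw \<Sigma> *v \<omega> \<in> Y)"
  by (auto simp: steady_refs_def pontryagin_diff_def)

lemma convex_Sbar: "convex Sbar"
  unfolding convex_alt
proof (intro ballI allI impI)
  fix v v' and s :: real assume v: "v \<in> Sbar" "v' \<in> Sbar" and s: "0 \<le> s \<and> s \<le> 1"
  show "(1 - s) *\<^sub>R v + s *\<^sub>R v' \<in> Sbar"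
    unfolding Sbar_iff
  proof (intro ballI)
    fix p \<omega> assume "p \<in> P" "\<omega> \<in> W"
    then have "(1 - s) *\<^sub>R (output_gain \<Sigma> *v v + C_K \<Sigma> *v p + mat_Dw \<Sigma> *v \<omega>) +
        s *\<^sub>R (output_gain \<Sigma> *v v' + C_K \<Sigma> *v p + mat_Dw \<Sigma> *v \<omega>) \<in> Ybar"
      using v s by (intro convexD_alt[OF Ybar(2)]) (auto simp: Sbar_iff)
    then show "output_gain \<Sigma> *v ((1 - s) *\<^sub>R v + s *\<^sub>R v') + C_K \<Sigma> *v p + mat_Dw \<Sigma> *v \<omega> \<in> Ybar"
      by (simp add: matrix_vector_right_distrib matrix_vector_mult_scaleR algebra_simps)
  qed
qed

lemma convex_Sv: "convex Sv"
  unfolding convex_alt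
proof (intro ballI allI impI)
  fix v v' and s :: real assume v: "v \<in> Sv" "v' \<in> Sv" and s: "0 \<le> s \<and> s \<le> 1"
  show "(1 - s) *\<^sub>R v + s *\<^sub>R v' \<in> Sv"
    unfolding Sv_iff
  proof (intro ballI)
    fix \<omega> assume "\<omega> \<in> W"
    then have "(1 - s) *\<^sub>R (output_gain \<Sigma> *v v + mat_Dw \<Sigma> *v \<omega>) +
        s *\<^sub>R (output_gain \<Sigma> *v v' + mat_Dw \<Sigma> *v \<omega>) \<in> Y"
      using v s by (intro convexD_alt[OF Y(2)]) (auto simp: Sv_iff)
    then show "output_gain \<Sigma> *v ((1 - s) *\<^sub>R v + s *\<^sub>R v') + mat_Dw \<Sigma> *v \<omega> \<in> Y"
      by (simp add: matrix_vector_right_distrib matrix_vector_mult_scaleR algebra_simps)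
  qed
qed

lemma closed_Sbar: "closed Sbar"
proof -
  have "Sbar = (\<Inter>p\<in>P. \<Inter>\<omega>\<in>W.
      (\<lambda>v. output_gain \<Sigma> *v v + C_K \<Sigma> *v p + mat_Dw \<Sigma> *v \<omega>) -` Ybar)"
    by (auto simp: Sbar_iff)
  moreover have "closed ((\<lambda>v. output_gain \<Sigma> *v v + C_K \<Sigma> *v p + mat_Dw \<Sigma> *v \<omega>) -` Ybar)" for p \<omega>
    by (intro closed_vimage compact_imp_closed Ybar continuous_intros)
  ultimately show ?thesis by (simp only:) (intro closed_INT ballI, blast)
qed

text \<open>The output margin divided by a bound on the gain is a margin for references. It puts the
  tightened set into the interior of \<open>Sv\<close>, where gradients are controlled.\<close>

lemma Sbar_margin: "\<exists>\<delta>>0. \<forall>v\<in>Sbar. cball v \<delta> \<subseteq> Sv"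
proof -
  obtain d where d: "d > 0" "\<And>y. y \<in> Ybar \<Longrightarrow> cball y d \<subseteq> Y"
    using output_margin by blast
  define N where "N = onorm ((*v) (output_gain \<Sigma>)) + 1"
  have N: "N > 0" using onorm_matrix_nonneg[of "output_gain \<Sigma>"] by (simp add: N_def)
  have "cball v (d / N) \<subseteq> Sv" if v: "v \<in> Sbar" for v
  proof
    fix z assume z: "z \<in> cball v (d / N)"
    show "z \<in> Sv" unfolding Sv_iff
    proof
      fix \<omega> assume "\<omega> \<in> W"
      then have y: "output_gain \<Sigma> *v v + mat_Dw \<Sigma> *v \<omega> \<in> Ybar" (is "?y \<in> _")
        using v zero_in_P by (fastforce simp: Sbar_iff)
      have "dist ?y (output_gain \<Sigma> *v z + mat_Dw \<Sigma> *v \<omega>) = norm (output_gain \<Sigma> *v (v - z))"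
        by (simp add: dist_norm matrix_vector_mult_diff_distrib)
      also have "\<dots> \<le> N * norm (v - z)"
        using norm_matrix_vector_le[of "output_gain \<Sigma>" "v - z"] by (simp add: N_def algebra_simps add_increasing)
      also have "\<dots> \<le> d" using z N by (simp add: dist_norm field_simps)
      finally show "output_gain \<Sigma> *v z + mat_Dw \<Sigma> *v \<omega> \<in> Y"
        using d(2)[OF y] by auto
    qed
  qed
  then show ?thesis using d(1) N by (intro exI[of _ "d / N"]) auto
qed

text \<open>With zero initial error the outputs stay in \<open>Ybar\<close>. An initial error \<xi>
  adds C (A / lam)^t \<xi>, bounded uniformly in t because lam exceeds the spectral radius; a small
  \<xi> therefore only uses up the margin.\<close>

lemma Sbar_Omega_margin: "\<exists>\<delta>>0. \<forall>v\<in>Sbar. \<forall>\<xi>. norm \<xi> \<le> \<delta> \<longrightarrow> (v, \<xi>) \<in> Omega"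
proof -
  obtain d where d: "d > 0" "\<And>y. y \<in> Ybar \<Longrightarrow> cball y d \<subseteq> Y"
    using output_margin by blast
  obtain M where M: "M \<ge> 1" "\<And>k x. norm (((*v) A ^^ k) x) \<le> M * lam ^ k * norm x"
    using power_bound[OF lam(1)] by metis
  define N where "N = (onorm ((*v) (C_K \<Sigma>)) + 1) * M"
  have N: "N > 0" using M(1) onorm_matrix_nonneg[of "C_K \<Sigma>"] by (auto simp: N_def intro!: mult_pos_pos)
  have "(v, \<xi>) \<in> Omega" if v: "v \<in> Sbar" and \<xi>: "norm \<xi> \<le> d / N" for v \<xi>
    unfolding max_output_admissible_def mem_Collect_eq prod.case
  proof (intro allI impI)
    fix \<omega> :: "nat \<Rightarrow> real^'o" and t assume \<omega>: "\<forall>t. \<omega> t \<in> W"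
    define D where "D = (1 / lam) ^ t *\<^sub>R ((*v) A ^^ t) \<xi>"
    have y: "out \<omega> v 0 t \<in> Ybar"
      using v err_zero_in_P[of \<omega> t] \<omega> by (auto simp: Sbar_iff add.commute)
    have "norm D = (1 / lam) ^ t * norm (((*v) A ^^ t) \<xi>)"
      using lam_pos by (simp add: D_def)
    also have "\<dots> \<le> (1 / lam) ^ t * (M * lam ^ t * norm \<xi>)"
      using lam_pos M by (intro mult_left_mono) auto
    also have "\<dots> = M * norm \<xi>" using lam_pos by (simp add: field_simps)
    finally have D: "norm D \<le> M * norm \<xi>" .
    have "dist (out \<omega> v 0 t) (out \<omega> v \<xi> t) = norm (C_K \<Sigma> *v D)"
      by (subst (2) err_decomp) (simp add: D_def dist_norm matrix_vector_right_distrib)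
    also have "\<dots> \<le> (onorm ((*v) (C_K \<Sigma>)) + 1) * norm D"
      using norm_matrix_vector_le[of "C_K \<Sigma>" D] by (simp add: algebra_simps add_increasing)
    also have "\<dots> \<le> N * norm \<xi>"
      unfolding N_def mult.assoc
      using D onorm_matrix_nonneg[of "C_K \<Sigma>"] by (intro mult_left_mono) auto
    also have "\<dots> \<le> d" using \<xi> N by (simp add: field_simps)
    finally show "out \<omega> v \<xi> t \<in> Y" using d(2)[OF y] by auto
  qed
  then show ?thesis using d(1) N by (intro exI[of _ "d / N"]) auto
qed

section \<open>The output admissible set and the governor step\<close>

lemma convex_Omega: "convex Omega"
  unfolding convex_alt
proof (intro ballI allI impI)
  fix a b :: "(real^'m) \<times> (real^'n)" and s :: real
  assume ab: "a \<in> Omega" "b \<in> Omega" and s: "0 \<le> s \<and> s \<le> 1"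
  obtain v \<epsilon> v' \<epsilon>' where eq: "a = (v, \<epsilon>)" "b = (v', \<epsilon>')" by fastforce
  have "out \<omega> ((1 - s) *\<^sub>R v + s *\<^sub>R v') ((1 - s) *\<^sub>R \<epsilon> + s *\<^sub>R \<epsilon>') t \<in> Y"
    if \<omega>: "\<forall>t. \<omega> t \<in> W" for \<omega> t
  proof -
    have "(1 - s) *\<^sub>R out \<omega> v \<epsilon> t + s *\<^sub>R out \<omega> v' \<epsilon>' t \<in> Y"
      using ab s \<omega> by (intro convexD_alt[OF Y(2)]) (auto simp: eq max_output_admissible_def)
    then show ?thesis
      unfolding err_affine
      by (simp add: matrix_vector_right_distrib matrix_vector_mult_scaleR algebra_simps)
  qed
  then show "(1 - s) *\<^sub>R a + s *\<^sub>R b \<in> Omega"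
    by (simp add: eq max_output_admissible_def)
qed

lemma closed_Omega: "closed Omega"
proof -
  have err: "continuous_on UNIV (\<lambda>z :: (real^'m) \<times> (real^'n). err \<omega> (snd z) t)" for \<omega> t
    by (induction t) (auto intro!: continuous_intros)
  have "Omega = (\<Inter>\<omega>\<in>{\<omega>. \<forall>t. \<omega> t \<in> W}. \<Inter>t. (\<lambda>z. out \<omega> (fst z) (snd z) t) -` Y)"
    by (auto simp: max_output_admissible_def)
  moreover have "closed ((\<lambda>z. out \<omega> (fst z) (snd z) t) -` Y)" for \<omega> t
    by (intro closed_vimage compact_imp_closed Y continuous_intros err)
  ultimately show ?thesis by (simp only:) (intro closed_INT ballI, blast)
qed

text \<open>A disturbance sequence prefixed by \<omega>0 is again admissible, so the constraints
  after the step are among the old ones, shifted by one.\<close>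

lemma Omega_step:
  assumes "(v, \<epsilon>) \<in> Omega" "\<omega>0 \<in> W"
  shows "(v, (1 / lam) *\<^sub>R (A *v \<epsilon> + Bw *v \<omega>0)) \<in> Omega"
  unfolding max_output_admissible_def mem_Collect_eq prod.case
proof (intro allI impI)
  fix \<omega> :: "nat \<Rightarrow> real^'o" and t assume "\<forall>t. \<omega> t \<in> W"
  then have "\<forall>t. case_nat \<omega>0 \<omega> t \<in> W" using assms(2) by (simp split: nat.split)
  then have "out (case_nat \<omega>0 \<omega>) v \<epsilon> (Suc t) \<in> Y"
    using assms(1) unfolding max_output_admissible_def by blast
  then show "out \<omega> v ((1 / lam) *\<^sub>R (A *v \<epsilon> + Bw *v \<omega>0)) t \<in> Y"
    unfolding err_shift by simp
qed

text \<open>The new point is the combination of \<open>(v, \<epsilon>\<^sup>+ / \<lambda>)\<close>, \<open>(v, \<xi>)\<close> and \<open>(r, \<xi>)\<close> with weights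
  \<open>\<lambda>\<close>, \<open>(1 - \<lambda>) (1 - \<beta>)\<close> and \<open>(1 - \<lambda>) \<beta>\<close>, where \<open>\<xi> = - \<beta> S\<^sub>K (r - v)\<close>: the
  contraction by \<open>\<lambda>\<close> is what leaves room for a fixed fraction of the step towards \<open>r\<close>.\<close>

lemma Omega_reference_step:
  assumes margin: "\<And>v \<xi>. v \<in> Sbar \<Longrightarrow> norm \<xi> \<le> \<delta> \<Longrightarrow> (v, \<xi>) \<in> Omega"
    and v: "(v, \<epsilon>) \<in> Omega" "v \<in> Sbar" and r: "r \<in> Sbar" and w: "w \<in> W"
    and \<beta>: "0 \<le> \<beta>" "\<beta> \<le> 1" "\<beta> * norm (S *v (r - v)) \<le> \<delta>"
  shows "(v + ((1 - lam) * \<beta>) *\<^sub>R (r - v),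
      A *v \<epsilon> + Bw *v w - ((1 - lam) * \<beta>) *\<^sub>R (S *v (r - v))) \<in> Omega"
proof -
  define \<xi> where "\<xi> = - (\<beta> *\<^sub>R (S *v (r - v)))"
  have \<xi>: "norm \<xi> \<le> \<delta>" using \<beta> by (simp add: \<xi>_def)
  have 1: "(1 - \<beta>) *\<^sub>R (v, \<xi>) + \<beta> *\<^sub>R (r, \<xi>) \<in> Omega"
    using \<beta> v r margin \<xi> by (intro convexD_alt[OF convex_Omega]) auto
  have "(1 - lam) *\<^sub>R ((1 - \<beta>) *\<^sub>R (v, \<xi>) + \<beta> *\<^sub>R (r, \<xi>)) +
      lam *\<^sub>R (v, (1 / lam) *\<^sub>R (A *v \<epsilon> + Bw *v w)) \<in> Omega"
    using lam lam_pos by (intro convexD_alt[OF convex_Omega 1 Omega_step] v w) auto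
  also have "(1 - lam) *\<^sub>R ((1 - \<beta>) *\<^sub>R (v, \<xi>) + \<beta> *\<^sub>R (r, \<xi>)) +
      lam *\<^sub>R (v, (1 / lam) *\<^sub>R (A *v \<epsilon> + Bw *v w)) =
      (v + ((1 - lam) * \<beta>) *\<^sub>R (r - v),
      A *v \<epsilon> + Bw *v w - ((1 - lam) * \<beta>) *\<^sub>R (S *v (r - v)))"
    using lam_pos by (simp add: \<xi>_def algebra_simps flip: scaleR_add_left)
  finally show ?thesis .
qed

text \<open>The feasible step sizes form a compact set that contains a, so the maximum behind
  \<open>GREATEST\<close> is attained. Any known feasible a bounds the actual step from
  below.\<close>

lemma governor_step_feasible:
  assumes "0 \<le> a" "a \<le> 1" "(v + a *\<^sub>R (r - v), x - S *v (v + a *\<^sub>R (r - v))) \<in> Omega"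
  defines "\<alpha> \<equiv> governor_step \<Sigma> Omega x v r"
  shows "a \<le> \<alpha>" "\<alpha> \<le> 1" "(v + \<alpha> *\<^sub>R (r - v), x - S *v (v + \<alpha> *\<^sub>R (r - v))) \<in> Omega"
proof -
  let ?F = "\<lambda>\<alpha>. (v + \<alpha> *\<^sub>R (r - v), x - S *v (v + \<alpha> *\<^sub>R (r - v)))"
  have "closed (?F -` Omega)"
    by (intro closed_vimage closed_Omega continuous_intros)
  then have "compact ({0..1} \<inter> ?F -` Omega)"
    by (simp add: compact_Int_closed)
  moreover have "a \<in> {0..1} \<inter> ?F -` Omega" using assms by auto
  ultimately have "\<exists>b\<in>{0..1} \<inter> ?F -` Omega. \<forall>c\<in>{0..1} \<inter> ?F -` Omega. c \<le> b"
    by (intro compact_attains_sup) auto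
  then obtain b where b: "b \<in> {0..1} \<inter> ?F -` Omega"
      "\<And>c. c \<in> {0..1} \<inter> ?F -` Omega \<Longrightarrow> c \<le> b"
    by (elim bexE) (rule that, assumption, erule bspec)
  have "\<alpha> = b"
    unfolding \<alpha>_def governor_step_def using b by (intro Greatest_equality) auto
  then show "a \<le> \<alpha>" "\<alpha> \<le> 1" "?F \<alpha> \<in> Omega"
    using b assms by auto
qed

end

section \<open>The closed loop and its regret\<close>

locale closed_loop_run = governed_system \<Sigma> Y Ybar W P lam
  for \<Sigma> :: "('n::finite, 'm::finite, 'o::finite, 'p::finite) control_system"
    and Y Ybar :: "(real^'p) set" and W :: "(real^'o) set" and P :: "(real^'n) set"
    and lam :: real +
  fixes x0 :: "real^'n" and r0 :: "real^'m" and \<gamma> lL \<alpha>v lv :: real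
    and w :: "nat \<Rightarrow> real^'o" and L :: "nat \<Rightarrow> (real^'m) \<times> (real^'n) \<Rightarrow> real"
  assumes pos: "lL > 0" "\<alpha>v > 0" "lv > 0"
    and r0: "r0 \<in> tightened_refs \<Sigma> Ybar W P"
    and x0: "(r0, x0 - S_K \<Sigma> *v r0) \<in> max_output_admissible \<Sigma> lam Y W"
    and \<gamma>: "0 < \<gamma>" "\<gamma> * lv \<le> 2"
    and w: "\<And>t. w t \<in> W"
    and lip: "\<And>t. lL-lipschitz_on (admissible_pairs \<Sigma> Y) (L t)"
    and sconvex: "\<And>t. strongly_convex_on \<alpha>v (steady_refs \<Sigma> Y W) (steady_cost \<Sigma> (L t))"
    and smooth: "\<And>t. lipschitz_gradient_on lv (steady_refs \<Sigma> Y W) (steady_cost \<Sigma> (L t))"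
begin

abbreviation "loop t \<equiv> closed_loop \<Sigma> Omega Sbar \<gamma> x0 r0 L w t"
abbreviation "cost t \<equiv> steady_cost \<Sigma> (L t)"

definition "x t = fst (loop t)"
definition "v t = fst (snd (loop t))"
definition "r t = snd (snd (loop t))"
definition "e t = x t - S *v v t"
definition "\<eta> t = opt_ref \<Sigma> Sbar L t"
definition "gov t = governor_step \<Sigma> Omega (x (Suc t)) (v t) (r (Suc t))"
text \<open>\<open>state_gain\<close> and \<open>ref_gain\<close> are Lipschitz constants of (K x,
  x) in x and of the steady pair in the reference. None of these four constants depends on w or
  L.\<close>

definition "state_gain = 1 + onorm ((*v) K)"
definition "ref_gain = 1 + state_gain * onorm ((*v) S)"
definition "diam_bound = 4 * (lL * ref_gain) / \<alpha>v"
definition "rate = sqrt (max 0 (1 - \<gamma> * (2 - \<gamma> * lv) * \<alpha>v))"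

lemma init [simp]: "x 0 = x0" "v 0 = r0" "r 0 = r0"
  by (simp_all add: x_def v_def r_def)

lemma step:
  "x (Suc t) = A *v x t + mat_B \<Sigma> *v v t + Bw *v w t"
  "r (Suc t) = closest_point Sbar (r t - \<gamma> *\<^sub>R grad (cost t) (r t))"
  "v (Suc t) = v t + gov t *\<^sub>R (r (Suc t) - v t)"
  by (simp_all add: x_def v_def r_def gov_def Let_def case_prod_unfold A_K_def
      matrix_vector_mult_add_rdistrib matrix_vector_right_distrib matrix_vector_mul_assoc)

text \<open>The new state is compared with the equilibrium of the old reference, so that the
  equilibrium equation cancels the input.\<close>

lemma error_step: "x (Suc t) - S *v v t = A *v e t + Bw *v w t"
  using S_K_fixed_point[of "v t"]
  by (simp add: step(1) e_def matrix_vector_mult_diff_distrib algebra_simps)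

lemma Sbar_subset_Sv: "Sbar \<subseteq> Sv"
proof -
  obtain \<delta> where "\<delta> > 0" and \<delta>: "\<And>a. a \<in> Sbar \<Longrightarrow> cball a \<delta> \<subseteq> Sv"
    using Sbar_margin by (elim exE conjE) (rule that, assumption, erule bspec)
  then have "a \<in> cball a \<delta>" for a by simp
  then show ?thesis using \<delta> by (meson subsetD subsetI)
qed

lemma Sbar_nonempty: "Sbar \<noteq> {}"
  using r0 by blast

lemma r_in_Sbar: "r t \<in> Sbar"
  by (cases t) (use r0 closest_point_in_set[OF closed_Sbar Sbar_nonempty] in \<open>auto simp: step(2)\<close>)

text \<open>Keeping the old reference, that is \<beta> = 0, is always feasible, so the maximal step
  exists. Membership at the next time needs the bounds on the current step, and these need the
  current membership; hence one joint induction.\<close>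

lemma gov_and_invariant:
  "0 \<le> gov t \<and> gov t \<le> 1 \<and> v t \<in> Sbar \<and> (v t, e t) \<in> Omega"
proof (induction t rule: less_induct)
  case (less t)
  have inv: "v t \<in> Sbar \<and> (v t, e t) \<in> Omega"
  proof (cases t)
    case 0
    then show ?thesis using r0 x0 by (simp add: e_def)
  next
    case (Suc s)
    have IH: "v s \<in> Sbar" "(v s, e s) \<in> Omega" "0 \<le> gov s" "gov s \<le> 1"
      using less.IH[of s] Suc by auto
    obtain \<delta> where \<delta>: "\<delta> > 0" "\<And>v \<xi>. v \<in> Sbar \<Longrightarrow> norm \<xi> \<le> \<delta> \<Longrightarrow> (v, \<xi>) \<in> Omega"
      using Sbar_Omega_margin by blast
    have "(v s, A *v e s + Bw *v w s) \<in> Omega"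
      using Omega_reference_step[OF \<delta>(2) IH(2,1) IH(1) w[of s], where \<beta> = 0] \<delta>(1) by simp
    then have "(v s + 0 *\<^sub>R (r (Suc s) - v s), x (Suc s) - S *v (v s + 0 *\<^sub>R (r (Suc s) - v s))) \<in> Omega"
      using error_step[of s] by simp
    from governor_step_feasible(3)[OF _ _ this] have "(v (Suc s), e (Suc s)) \<in> Omega"
      by (simp add: gov_def e_def step(3))
    moreover have "v (Suc s) \<in> Sbar"
      using convexD_alt[OF convex_Sbar IH(1) r_in_Sbar IH(3,4), of "Suc s"]
      by (simp add: step(3) algebra_simps)
    ultimately show ?thesis using Suc by simp
  qed
  obtain \<delta> where \<delta>: "\<delta> > 0" "\<And>v \<xi>. v \<in> Sbar \<Longrightarrow> norm \<xi> \<le> \<delta> \<Longrightarrow> (v, \<xi>) \<in> Omega"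
    using Sbar_Omega_margin by blast
  have "(v t, A *v e t + Bw *v w t) \<in> Omega"
    using Omega_reference_step[OF \<delta>(2) _ _ _ w[of t], where v = "v t" and \<epsilon> = "e t" and r = "v t" and \<beta> = 0] inv \<delta>(1) by simp
  then have "(v t + 0 *\<^sub>R (r (Suc t) - v t), x (Suc t) - S *v (v t + 0 *\<^sub>R (r (Suc t) - v t))) \<in> Omega"
    using error_step[of t] by simp
  from governor_step_feasible(1,2)[OF _ _ this] show ?case
    using inv by (simp add: gov_def)
qed

lemma v_in_Sbar: "v t \<in> Sbar" and ve_in_Omega: "(v t, e t) \<in> Omega"
  and gov_le_1: "gov t \<le> 1"
  using gov_and_invariant by auto

lemma gains: "1 \<le> state_gain" "1 \<le> ref_gain"
  using onorm_matrix_nonneg[of K] onorm_matrix_nonneg[of S] by (simp_all add: state_gain_def ref_gain_def)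

section \<open>Lipschitz estimates, diameter and optimal references\<close>

lemma pair_dist_le:
  "dist (a + K *v y, y) (b + K *v z, z) \<le> norm (a - b) + state_gain * norm (y - z)"
proof -
  have "dist (a + K *v y, y) (b + K *v z, z) \<le> norm (a - b + K *v (y - z)) + norm (y - z)"
    unfolding dist_norm
    by (rule order_trans[OF _ norm_Pair_le]) (simp add: matrix_vector_mult_diff_distrib algebra_simps)
  also have "\<dots> \<le> norm (a - b) + norm (K *v (y - z)) + norm (y - z)"
    by (intro add_right_mono norm_triangle_ineq)
  also have "\<dots> \<le> norm (a - b) + state_gain * norm (y - z)"
    using norm_matrix_vector_le[of K "y - z"] by (simp add: state_gain_def algebra_simps)
  finally show ?thesis .
qed

lemma steady_pair_admissible:
  assumes "a \<in> Sv"
  shows "(a + K *v (S *v a), S *v a) \<in> admissible_pairs \<Sigma> Y"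
proof -
  have "output_gain \<Sigma> *v a + mat_Dw \<Sigma> *v 0 \<in> Y"
    using assms W0 unfolding Sv_iff by blast
  then show ?thesis
    by (simp add: admissible_pairs_def output_gain_def C_K_def matrix_vector_mult_add_rdistrib
        matrix_vector_right_distrib algebra_simps flip: matrix_vector_mul_assoc)
qed

text \<open>The constraint at the initial time of the prediction, with zero disturbance, is
  admissibility of the current pair.\<close>

lemma closed_loop_admissible: "(v t + K *v x t, x t) \<in> admissible_pairs \<Sigma> Y"
proof -
  have "\<forall>\<omega>. (\<forall>t. \<omega> t \<in> W) \<longrightarrow> (\<forall>k. out \<omega> (v t) (e t) k \<in> Y)"
    using ve_in_Omega[of t] by (simp add: max_output_admissible_def)
  from spec[OF this, of "\<lambda>_. 0"] W0 have "\<forall>k. out (\<lambda>_. 0) (v t) (e t) k \<in> Y" by simp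
  from spec[OF this, of 0] have "out (\<lambda>_. 0) (v t) (e t) 0 \<in> Y" .
  then have "C_K \<Sigma> *v e t + output_gain \<Sigma> *v v t \<in> Y" by simp
  then show ?thesis
    by (simp add: admissible_pairs_def output_gain_def C_K_def e_def matrix_vector_mult_add_rdistrib
        matrix_vector_right_distrib matrix_vector_mult_diff_distrib algebra_simps flip: matrix_vector_mul_assoc)
qed

lemma cost_lipschitz: "(lL * ref_gain)-lipschitz_on Sv (cost t)"
proof (rule lipschitz_onI)
  show "0 \<le> lL * ref_gain" using pos gains by simp
  fix a b assume ab: "a \<in> Sv" "b \<in> Sv"
  have "dist (cost t a) (cost t b)
      \<le> lL * dist (a + K *v (S *v a), S *v a) (b + K *v (S *v b), S *v b)"
    unfolding steady_cost_def by (intro lipschitz_onD[OF lip] steady_pair_admissible ab)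
  also have "\<dots> \<le> lL * (norm (a - b) + state_gain * (onorm ((*v) S) * norm (a - b)))"
  proof (intro mult_left_mono order_trans[OF pair_dist_le] add_left_mono)
    show "norm (S *v a - S *v b) \<le> onorm ((*v) S) * norm (a - b)"
      using norm_matrix_vector_le[of S "a - b"] by (simp add: matrix_vector_mult_diff_distrib)
  qed (use gains pos in auto)
  finally show "dist (cost t a) (cost t b) \<le> lL * ref_gain * dist a b"
    by (simp add: ref_gain_def dist_norm algebra_simps)
qed

lemma Sv_diam: "a \<in> Sv \<Longrightarrow> b \<in> Sv \<Longrightarrow> norm (a - b) \<le> diam_bound"
  unfolding diam_bound_def
  by (rule strongly_convex_lipschitz_dist_le[OF sconvex cost_lipschitz convex_Sv pos(2)])

lemma Sbar_diam: "a \<in> Sbar \<Longrightarrow> b \<in> Sbar \<Longrightarrow> norm (a - b) \<le> diam_bound"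
  by (intro Sv_diam subsetD[OF Sbar_subset_Sv])

text \<open>\<open>arg_min_on\<close> is a choice and means something only if a minimizer exists.
  Compactness comes from the diameter bound, since the output gain may have a kernel.\<close>

lemma opt_ref_minimal: "\<eta> t \<in> Sbar" "b \<in> Sbar \<Longrightarrow> cost t (\<eta> t) \<le> cost t b"
proof -
  have "bounded Sbar"
    unfolding bounded_def dist_norm
    by (intro exI[of _ r0] exI[of _ diam_bound] ballI Sbar_diam r0)
  then have "compact Sbar" using closed_Sbar compact_eq_bounded_closed by blast
  moreover have "continuous_on Sbar (cost t)"
    using lipschitz_on_continuous_on[OF cost_lipschitz] Sbar_subset_Sv continuous_on_subset by blast
  ultimately have "\<exists>a\<in>Sbar. \<forall>b\<in>Sbar. cost t a \<le> cost t b"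
    using Sbar_nonempty by (intro continuous_attains_inf)
  then obtain a where "a \<in> Sbar" "\<forall>b\<in>Sbar. cost t a \<le> cost t b"
    by (elim bexE) (rule that)
  then have "is_arg_min (cost t) (\<lambda>a. a \<in> Sbar) a"
    by (simp add: is_arg_min_linorder)
  then have "is_arg_min (cost t) (\<lambda>a. a \<in> Sbar) (\<eta> t)"
    unfolding \<eta>_def opt_ref_def arg_min_on_def arg_min_def by (rule someI)
  then show "\<eta> t \<in> Sbar" "b \<in> Sbar \<Longrightarrow> cost t (\<eta> t) \<le> cost t b"
    by (auto simp: is_arg_min_linorder)
qed

lemma rate_nonneg: "0 \<le> rate"
  by (simp add: rate_def)

text \<open>The algorithm uses \<open>grad\<close>, the contraction a relative gradient g; they
  agree at r t, an interior point of \<open>Sv\<close>.\<close>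

lemma reference_contraction: "norm (r (Suc t) - \<eta> t) \<le> rate * norm (r t - \<eta> t)"
proof -
  obtain g where g0: "\<forall>a\<in>Sv. (cost t has_derivative (\<lambda>h. g a \<bullet> h)) (at a within Sv)"
    and g': "lv-lipschitz_on Sv g"
    using smooth[of t] unfolding lipschitz_gradient_on_def by (elim exE conjE) (rule that)
  have g: "(cost t has_derivative (\<lambda>h. g a \<bullet> h)) (at a within Sv)" if "a \<in> Sv" for a
    using g0 that by (rule bspec)
  have "smooth_strongly_convex Sv (cost t) g \<alpha>v lv"
    by unfold_locales (use g g' convex_Sv sconvex pos in auto)
  moreover obtain \<delta> where \<delta>: "\<delta> > 0" "\<And>a. a \<in> Sbar \<Longrightarrow> cball a \<delta> \<subseteq> Sv"
    using Sbar_margin by blast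
  ultimately have "norm (closest_point Sbar (r t - \<gamma> *\<^sub>R g (r t)) - \<eta> t) \<le> rate * norm (r t - \<eta> t)"
    unfolding rate_def
    by (rule projected_gradient_contraction[OF _ convex_Sbar closed_Sbar _ _ \<gamma>])
       (use opt_ref_minimal r_in_Sbar in auto)
  moreover have "r t \<in> interior Sv"
    using \<delta> r_in_Sbar[of t] by (meson ball_subset_cball mem_interior subset_trans)
  then have "grad (cost t) (r t) = g (r t)"
    using r_in_Sbar Sbar_subset_Sv by (intro grad_eqI[OF g]) auto
  ultimately show ?thesis by (simp add: step(2))
qed

text \<open>The diameter bound limits the jump of the equilibrium, so that one \<beta> fits the
  margin \<delta> at all times.\<close>

lemma gov_ge:
  assumes margin: "\<And>v \<xi>. v \<in> Sbar \<Longrightarrow> norm \<xi> \<le> \<delta> \<Longrightarrow> (v, \<xi>) \<in> Omega"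
    and \<beta>: "0 \<le> \<beta>" "\<beta> \<le> 1" "\<beta> * (onorm ((*v) S) * diam_bound) \<le> \<delta>"
  shows "(1 - lam) * \<beta> \<le> gov t"
proof -
  let ?d = "r (Suc t) - v t"
  have "\<beta> * norm (S *v ?d) \<le> \<beta> * (onorm ((*v) S) * norm ?d)"
    using \<beta> norm_matrix_vector_le by (intro mult_left_mono) auto
  also have "\<dots> \<le> \<beta> * (onorm ((*v) S) * diam_bound)"
    using \<beta> Sbar_diam[OF r_in_Sbar v_in_Sbar] onorm_matrix_nonneg by (intro mult_left_mono) auto
  finally have "\<beta> * norm (S *v ?d) \<le> \<delta>" using \<beta> by simp
  from Omega_reference_step[OF margin ve_in_Omega v_in_Sbar r_in_Sbar w[of t] \<beta>(1,2) this]
  have "(v t + ((1 - lam) * \<beta>) *\<^sub>R ?d, x (Suc t) - S *v (v t + ((1 - lam) * \<beta>) *\<^sub>R ?d)) \<in> Omega"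
    by (simp only: matrix_vector_right_distrib matrix_vector_mult_scaleR flip: error_step diff_diff_eq)
  moreover have "0 \<le> (1 - lam) * \<beta>" "(1 - lam) * \<beta> \<le> 1"
    using lam lam_pos \<beta> by (auto intro: mult_le_one)
  ultimately show ?thesis using governor_step_feasible(1) unfolding gov_def by blast
qed

text \<open>The difference x t - S \<eta> t is split at S v t, which separates the transient error
  from the reference error.\<close>

lemma regret_term_le:
  "L t (v t + K *v x t, x t) - L t (\<eta> t + K *v (S *v \<eta> t), S *v \<eta> t)
    \<le> lL * state_gain * norm (e t) + lL * ref_gain * norm (v t - \<eta> t)"
proof -
  have "dist (L t (v t + K *v x t, x t)) (L t (\<eta> t + K *v (S *v \<eta> t), S *v \<eta> t))
      \<le> lL * dist (v t + K *v x t, x t) (\<eta> t + K *v (S *v \<eta> t), S *v \<eta> t)"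
    by (intro lipschitz_onD[OF lip] closed_loop_admissible steady_pair_admissible
        subsetD[OF Sbar_subset_Sv] opt_ref_minimal(1))
  also have "\<dots> \<le> lL * (norm (v t - \<eta> t) + state_gain * (norm (e t) + onorm ((*v) S) * norm (v t - \<eta> t)))"
  proof (intro mult_left_mono order_trans[OF pair_dist_le] add_left_mono)
    have "x t - S *v \<eta> t = e t + S *v (v t - \<eta> t)"
      by (simp add: e_def matrix_vector_mult_diff_distrib)
    then show "norm (x t - S *v \<eta> t) \<le> norm (e t) + onorm ((*v) S) * norm (v t - \<eta> t)"
      using norm_matrix_vector_le[of S "v t - \<eta> t"] norm_triangle_ineq[of "e t" "S *v (v t - \<eta> t)"] by simp
  qed (use gains pos in auto)
  also have "\<dots> = lL * state_gain * norm (e t) + lL * ref_gain * norm (v t - \<eta> t)"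
    by (simp add: ref_gain_def algebra_simps)
  finally show ?thesis by (simp add: dist_real_def)
qed

lemma regret_eq:
  "regret \<Sigma> Omega Sbar \<gamma> x0 r0 L w T =
    (\<Sum>t\<le>T. L t (v t + K *v x t, x t) - L t (\<eta> t + K *v (S *v \<eta> t), S *v \<eta> t))"
  by (simp add: regret_def closed_loop_pair_def Let_def case_prod_unfold x_def v_def \<eta>_def atLeast0AtMost)

lemma regret_le:
  fixes T :: nat
  assumes rate: "rate < 1"
    and M: "M \<ge> 1" "\<And>k z. norm (((*v) A ^^ k) z) \<le> M * lam ^ k * norm z"
    and a: "0 < a" "a \<le> 1" "\<And>t. a \<le> gov t"
  defines "H \<equiv> (\<Sum>t<T. norm (\<eta> (Suc t) - \<eta> t))"
    and "R \<equiv> (2 / a + 2) * (onorm ((*v) S) * (lL * state_gain * M) / (1 - lam) + lL * ref_gain)"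
    and "E \<equiv> lL * state_gain * M / (1 - lam)"
  shows "regret \<Sigma> Omega Sbar \<gamma> x0 r0 L w T
    \<le> E * norm (e 0) + R * (diam_bound + H) / (1 - rate) + E * onorm ((*v) Bw) * (\<Sum>t<T. norm (w t))"
proof -
  define \<rho> where "\<rho> t = norm (r t - \<eta> t)" for t
  define \<sigma> where "\<sigma> t = norm (v t - r t)" for t
  define \<Delta> where "\<Delta> t = v (Suc t) - v t" for t
  \<comment> \<open>The bound for the sum of all \<rho> t; \<open>diam_bound\<close> replaces \<rho>
    0, which depends on the first cost.\<close>
  define J where "J = (diam_bound + H) / (1 - rate)"
  define NS where "NS = onorm ((*v) S)"
  define NB where "NB = onorm ((*v) Bw)"
  have N: "0 \<le> NS" "0 \<le> NB" by (simp_all add: NS_def NB_def onorm_matrix_nonneg)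

  have \<rho>_step: "\<rho> (Suc t) \<le> rate * \<rho> t + norm (\<eta> (Suc t) - \<eta> t)" for t
    using reference_contraction[of t] norm_triangle_ineq[of "r (Suc t) - \<eta> t" "\<eta> t - \<eta> (Suc t)"]
    by (simp add: \<rho>_def norm_minus_commute)
  have "(\<Sum>t\<le>T. \<rho> t) \<le> (\<rho> 0 + H) / (1 - rate)"
    unfolding H_def
    by (intro sum_linear_recursion_le rate \<rho>_step rate_nonneg) (simp add: \<rho>_def)
  also have "\<dots> \<le> J"
    unfolding J_def \<rho>_def using rate Sbar_diam[OF r_in_Sbar opt_ref_minimal(1)]
    by (intro divide_right_mono add_right_mono) (auto simp del: init)
  finally have sum_\<rho>: "(\<Sum>t\<le>T. \<rho> t) \<le> J" .
  have sum_\<rho>': "(\<Sum>t<T. \<rho> t) \<le> J"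
    by (rule order_trans[OF sum_mono2 sum_\<rho>]) (auto simp: \<rho>_def)

  have r_move: "norm (r (Suc t) - v t) \<le> \<sigma> t + 2 * \<rho> t" for t
  proof -
    have "norm (r (Suc t) - v t) \<le> norm (r (Suc t) - \<eta> t) + norm (\<eta> t - r t) + norm (r t - v t)"
      using norm_triangle_ineq[of "r (Suc t) - \<eta> t" "\<eta> t - v t"] norm_triangle_ineq[of "\<eta> t - r t" "r t - v t"] by simp
    also have "norm (r (Suc t) - \<eta> t) \<le> \<rho> t"
      using reference_contraction[of t] mult_right_mono[of rate 1 "\<rho> t"] rate by (simp add: \<rho>_def)
    finally show ?thesis by (simp add: \<rho>_def \<sigma>_def norm_minus_commute)
  qed
  have \<sigma>_step: "\<sigma> (Suc t) \<le> (1 - a) * \<sigma> t + 2 * \<rho> t" for t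
  proof -
    have "v (Suc t) - r (Suc t) = (gov t - 1) *\<^sub>R (r (Suc t) - v t)"
      by (simp add: step(3) algebra_simps)
    then have "\<sigma> (Suc t) = (1 - gov t) * norm (r (Suc t) - v t)"
      using gov_le_1[of t] by (simp add: \<sigma>_def)
    also have "\<dots> \<le> (1 - a) * (\<sigma> t + 2 * \<rho> t)"
      using a(3)[of t] gov_le_1[of t] r_move[of t] by (intro mult_mono) auto
    also have "\<dots> \<le> (1 - a) * \<sigma> t + 2 * \<rho> t"
      using a by (simp add: algebra_simps \<rho>_def)
    finally show ?thesis .
  qed
  have "(\<Sum>t\<le>T. \<sigma> t) \<le> (\<sigma> 0 + (\<Sum>t<T. 2 * \<rho> t)) / (1 - (1 - a))"
    using a by (intro sum_linear_recursion_le \<sigma>_step) (auto simp: \<sigma>_def)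
  \<comment> \<open>Both v and r start at r0, so \<sigma> 0 contributes nothing.\<close>
  also have "\<dots> = 2 / a * (\<Sum>t<T. \<rho> t)"
    by (simp add: \<sigma>_def flip: sum_distrib_left)
  also have "\<dots> \<le> 2 / a * J"
    using a sum_\<rho>' by (intro mult_left_mono) auto
  finally have sum_\<sigma>: "(\<Sum>t\<le>T. \<sigma> t) \<le> 2 / a * J" .
  have sum_\<sigma>': "(\<Sum>t<T. \<sigma> t) \<le> 2 / a * J"
    by (rule order_trans[OF sum_mono2 sum_\<sigma>]) (auto simp: \<sigma>_def)

  have \<Delta>_le: "norm (\<Delta> t) \<le> \<sigma> t + 2 * \<rho> t" for t
  proof -
    have "norm (\<Delta> t) = gov t * norm (r (Suc t) - v t)"
      using gov_and_invariant[of t] by (simp add: \<Delta>_def step(3))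
    also have "\<dots> \<le> 1 * norm (r (Suc t) - v t)"
      using gov_le_1[of t] by (intro mult_right_mono) auto
    finally show ?thesis using r_move[of t] by simp
  qed

  define d where "d t = Bw *v w t - S *v \<Delta> t" for t
  \<comment> \<open>A need not contract the Euclidean norm, so a scalar majorant with rate lam is
    carried along. The estimate \<open>e_z\<close> speaks of all powers of A to make the induction
    on t work; only k = 0 is used afterwards.\<close>
  define z where "z = rec_nat (norm (e 0)) (\<lambda>t y. lam * y + norm (d t))"
  have z: "z 0 = norm (e 0)" "\<And>t. z (Suc t) = lam * z t + norm (d t)"
    by (simp_all add: z_def)
  have z_nonneg: "0 \<le> z t" for t
    using lam_pos by (induction t) (simp_all add: z)
  have e_step: "e (Suc t) = A *v e t + d t" for t
    using error_step[of t]
    by (simp add: e_def d_def \<Delta>_def matrix_vector_mult_diff_distrib algebra_simps)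
  have pow_add: "((*v) A ^^ k) (p + q) = ((*v) A ^^ k) p + ((*v) A ^^ k) q" for k p q
    by (simp add: matrix_vector_right_distrib flip: mat_pow_mult_vec)
  have e_z: "norm (((*v) A ^^ k) (e t)) \<le> M * lam ^ k * z t" for k t
  proof (induction t arbitrary: k)
    case 0
    then show ?case using M(2) by (simp add: z)
  next
    case (Suc t)
    have "((*v) A ^^ k) (e (Suc t)) = ((*v) A ^^ Suc k) (e t) + ((*v) A ^^ k) (d t)"
      by (simp add: e_step pow_add funpow_swap1)
    also have "norm \<dots> \<le> M * lam ^ Suc k * z t + M * lam ^ k * norm (d t)"
      by (intro order_trans[OF norm_triangle_ineq] add_mono Suc.IH M(2))
    also have "\<dots> = M * lam ^ k * z (Suc t)" by (simp add: z algebra_simps)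
    finally show ?case .
  qed
  have "(\<Sum>t\<le>T. norm (e t)) \<le> (\<Sum>t\<le>T. M * z t)"
    using e_z[of 0] by (intro sum_mono) simp
  also have "\<dots> \<le> M * ((z 0 + (\<Sum>t<T. norm (d t))) / (1 - lam))"
    unfolding sum_distrib_left[symmetric] using M(1) lam(2) lam_pos z_nonneg
    by (intro mult_left_mono sum_linear_recursion_le) (auto simp: z)
  also have "\<dots> \<le> M * ((norm (e 0) + (\<Sum>t<T. NB * norm (w t) + NS * (\<sigma> t + 2 * \<rho> t))) / (1 - lam))"
  proof (intro mult_left_mono divide_right_mono add_mono sum_mono)
    fix t
    have "norm (d t) \<le> norm (Bw *v w t) + norm (S *v \<Delta> t)"
      unfolding d_def by (rule norm_triangle_ineq4)
    also have "\<dots> \<le> NB * norm (w t) + NS * norm (\<Delta> t)"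
      unfolding NB_def NS_def by (intro add_mono norm_matrix_vector_le)
    also have "\<dots> \<le> NB * norm (w t) + NS * (\<sigma> t + 2 * \<rho> t)"
      using N \<Delta>_le by (intro add_left_mono mult_left_mono) auto
    finally show "norm (d t) \<le> NB * norm (w t) + NS * (\<sigma> t + 2 * \<rho> t)" .
  qed (use M lam z in auto)
  also have "(\<Sum>t<T. NB * norm (w t) + NS * (\<sigma> t + 2 * \<rho> t))
      = NB * (\<Sum>t<T. norm (w t)) + NS * ((\<Sum>t<T. \<sigma> t) + 2 * (\<Sum>t<T. \<rho> t))"
    by (simp add: sum.distrib sum_distrib_left distrib_left)
  also have "M * ((norm (e 0) + \<dots>) / (1 - lam))
      \<le> M * ((norm (e 0) + (NB * (\<Sum>t<T. norm (w t)) + NS * (2 / a * J + 2 * J))) / (1 - lam))"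
    using M lam N sum_\<rho>' sum_\<sigma>'
    by (intro mult_left_mono divide_right_mono add_left_mono add_mono) auto
  finally have sum_e: "(\<Sum>t\<le>T. norm (e t))
      \<le> M * ((norm (e 0) + (NB * (\<Sum>t<T. norm (w t)) + NS * (2 / a * J + 2 * J))) / (1 - lam))" .

  have J: "0 \<le> J"
    using sum_\<rho> by (rule order_trans[rotated]) (auto simp: \<rho>_def intro: sum_nonneg)
  have "(\<Sum>t\<le>T. norm (v t - \<eta> t)) \<le> (\<Sum>t\<le>T. \<sigma> t + \<rho> t)"
  proof (rule sum_mono)
    fix t
    show "norm (v t - \<eta> t) \<le> \<sigma> t + \<rho> t"
      using norm_triangle_ineq[of "v t - r t" "r t - \<eta> t"] by (simp add: \<sigma>_def \<rho>_def)
  qed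
  also have "\<dots> \<le> 2 / a * J + 2 * J"
    using sum_\<rho> sum_\<sigma> J by (simp add: sum.distrib)
  finally have sum_v: "(\<Sum>t\<le>T. norm (v t - \<eta> t)) \<le> (2 / a + 2) * J"
    by (simp add: distrib_right)

  have "regret \<Sigma> Omega Sbar \<gamma> x0 r0 L w T
      \<le> (\<Sum>t\<le>T. lL * state_gain * norm (e t) + lL * ref_gain * norm (v t - \<eta> t))"
    unfolding regret_eq by (intro sum_mono regret_term_le)
  also have "\<dots> = lL * state_gain * (\<Sum>t\<le>T. norm (e t)) + lL * ref_gain * (\<Sum>t\<le>T. norm (v t - \<eta> t))"
    by (simp add: sum.distrib sum_distrib_left)
  also have "\<dots> \<le> lL * state_gain * (M * ((norm (e 0) + (NB * (\<Sum>t<T. norm (w t)) + NS * (2 / a * J + 2 * J))) / (1 - lam)))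
      + lL * ref_gain * ((2 / a + 2) * J)"
    using sum_e sum_v pos gains by (intro add_mono mult_left_mono) auto
  also have "\<dots> = E * norm (e 0) + R * J + E * NB * (\<Sum>t<T. norm (w t))"
    using lam by (simp add: E_def R_def NS_def add_divide_distrib algebra_simps)
  finally show ?thesis by (simp add: J_def NB_def)
qed

end

section \<open>Constants uniform in disturbances, costs and horizon\<close>

theorem theorem1:
  fixes \<Sigma> :: "('n::finite, 'm::finite, 'o::finite, 'p::finite) control_system"
    and Y Ybar :: "(real^'p) set"
    and W :: "(real^'o) set"
    and P :: "(real^'n) set"
    and x0 :: "real^'n"
    and r0 :: "real^'m"
    and lam \<gamma> lL \<alpha>v lv :: real
  assumes "stabilizable (mat_A \<Sigma>) (mat_B \<Sigma>)" and "schur_stable (A_K \<Sigma>)"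
    and "compact Y" and "convex Y" and "0 \<in> interior Y"
    and "compact W" and "convex W" and "0 \<in> interior W"
    and "spectral_radius (A_K \<Sigma>) < lam" and "lam < 1"
    and "robust_invariant \<Sigma> lam W P" and "min_robust_invariant \<Sigma> lam W \<subseteq> P"
    and "compact Ybar" and "convex Ybar" and "0 \<in> Ybar" and "Ybar \<subseteq> interior Y"
    and "lL > 0" and "\<alpha>v > 0" and "lv > 0"
    and "r0 \<in> tightened_refs \<Sigma> Ybar W P"
    and "(r0, x0 - S_K \<Sigma> *v r0) \<in> max_output_admissible \<Sigma> lam Y W"
    and "0 < \<gamma>" and "\<gamma> \<le> 2 / (\<alpha>v + lv)"
  shows "\<exists>c0 c\<eta> cw. c0 > 0 \<and> c\<eta> > 0 \<and> cw > 0 \<and>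
    (\<forall>(T :: nat) (w :: nat \<Rightarrow> real^'o) (L :: nat \<Rightarrow> (real^'m) \<times> (real^'n) \<Rightarrow> real).
      (\<forall>t. w t \<in> W) \<longrightarrow>
      (\<forall>t. lL-lipschitz_on (admissible_pairs \<Sigma> Y) (L t)) \<longrightarrow>
      (\<forall>t. strongly_convex_on \<alpha>v (steady_refs \<Sigma> Y W) (steady_cost \<Sigma> (L t))) \<longrightarrow>
      (\<forall>t. lipschitz_gradient_on lv (steady_refs \<Sigma> Y W) (steady_cost \<Sigma> (L t))) \<longrightarrow>
      regret \<Sigma> (max_output_admissible \<Sigma> lam Y W) (tightened_refs \<Sigma> Ybar W P) \<gamma> x0 r0 L w T
        \<le> c0
          + c\<eta> * (\<Sum>t=1..T. norm (opt_ref \<Sigma> (tightened_refs \<Sigma> Ybar W P) L t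
                              - opt_ref \<Sigma> (tightened_refs \<Sigma> Ybar W P) L (t - 1)))
          + cw * (\<Sum>t<T. norm (w t)))"
proof -
  interpret governed_system \<Sigma> Y Ybar W P lam
    by unfold_locales (use assms interior_subset in auto)
  \<comment> \<open>Positivity of \<gamma> \<alpha>v makes the bound on \<gamma> lv strict, which
    gives q < 1.\<close>
  have "\<gamma> * (\<alpha>v + lv) \<le> 2" using assms by (simp add: field_simps)
  moreover have "0 < \<gamma> * \<alpha>v" using assms by simp
  ultimately have \<gamma>lv: "\<gamma> * lv < 2" by (simp add: distrib_left)

  \<comment> \<open>The constants of a run are rebuilt before w and L are fixed, so that the
    witnesses cannot depend on them.\<close>
  define sg where "sg = 1 + onorm ((*v) K)"
  define rg where "rg = 1 + sg * onorm ((*v) S)"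
  define D where "D = 4 * (lL * rg) / \<alpha>v"
  define q where "q = sqrt (max 0 (1 - \<gamma> * (2 - \<gamma> * lv) * \<alpha>v))"
  have gains: "1 \<le> sg" "1 \<le> rg"
    using onorm_matrix_nonneg[of K] onorm_matrix_nonneg[of S] by (simp_all add: sg_def rg_def)
  have D: "0 \<le> D" using gains assms by (simp add: D_def)
  have q: "q < 1" using \<gamma>lv assms by (simp add: q_def)

  obtain \<delta> where \<delta>: "\<delta> > 0" "\<And>v \<xi>. v \<in> Sbar \<Longrightarrow> norm \<xi> \<le> \<delta> \<Longrightarrow> (v, \<xi>) \<in> Omega"
    using Sbar_Omega_margin by blast
  obtain M where M: "M \<ge> 1" "\<And>k x. norm (((*v) A ^^ k) x) \<le> M * lam ^ k * norm x"
    using power_bound[OF lam(1)] by metis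
  define ND where "ND = onorm ((*v) S) * D"
  have ND: "0 \<le> ND" using D onorm_matrix_nonneg[of S] by (simp add: ND_def)
  \<comment> \<open>Small enough for \<beta> times ND, the bound on equilibrium jumps, to fit the
    margin; ND + 1 avoids a zero divisor.\<close>
  define \<beta> where "\<beta> = min 1 (\<delta> / (ND + 1))"
  have \<beta>: "0 < \<beta>" "\<beta> \<le> 1" using \<delta>(1) ND by (simp_all add: \<beta>_def)
  have "\<beta> * ND \<le> \<delta> / (ND + 1) * ND"
    using ND by (intro mult_right_mono) (auto simp: \<beta>_def)
  also have "\<dots> \<le> \<delta>" using ND \<delta>(1) by (simp add: field_simps)
  finally have \<beta>\<delta>: "\<beta> * ND \<le> \<delta>" .
  define a where "a = (1 - lam) * \<beta>"
  have a: "0 < a" "a \<le> 1" using lam lam_pos \<beta> by (auto simp: a_def intro: mult_le_one)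

  define E where "E = lL * sg * M / (1 - lam)"
  define R where "R = (2 / a + 2) * (onorm ((*v) S) * (lL * sg * M) / (1 - lam) + lL * rg)"
  \<comment> \<open>The final 1 in each of the three constants makes it strictly positive.\<close>
  define c0 where "c0 = E * norm (x0 - S *v r0) + R * D / (1 - q) + 1"
  define c\<eta> where "c\<eta> = R / (1 - q) + 1"
  define cw where "cw = E * onorm ((*v) Bw) + 1"
  have E: "0 \<le> E" using assms gains M lam by (simp add: E_def)
  have R: "0 \<le> R"
    unfolding R_def using assms gains M lam a onorm_matrix_nonneg[of S]
    by (intro mult_nonneg_nonneg add_nonneg_nonneg divide_nonneg_nonneg) auto
  have c_pos: "0 < c0" "0 < c\<eta>" "0 < cw"
    using E R D q onorm_matrix_nonneg[of Bw]
    by (auto simp: c0_def c\<eta>_def cw_def intro!: add_nonneg_pos)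
  have bound: "regret \<Sigma> Omega Sbar \<gamma> x0 r0 L w T
      \<le> c0 + c\<eta> * (\<Sum>t=1..T. norm (opt_ref \<Sigma> Sbar L t - opt_ref \<Sigma> Sbar L (t - 1)))
          + cw * (\<Sum>t<T. norm (w t))"
    if w: "\<forall>t. w t \<in> W"
      and L: "\<forall>t. lL-lipschitz_on (admissible_pairs \<Sigma> Y) (L t)"
        "\<forall>t. strongly_convex_on \<alpha>v (steady_refs \<Sigma> Y W) (steady_cost \<Sigma> (L t))"
        "\<forall>t. lipschitz_gradient_on lv (steady_refs \<Sigma> Y W) (steady_cost \<Sigma> (L t))"
    for T w L
  proof -
    interpret run: closed_loop_run \<Sigma> Y Ybar W P lam x0 r0 \<gamma> lL \<alpha>v lv w L
      by unfold_locales (use assms \<gamma>lv w L in auto)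
    have eqs: "run.state_gain = sg" "run.ref_gain = rg" "run.diam_bound = D" "run.rate = q"
      by (simp_all add: run.state_gain_def run.ref_gain_def run.diam_bound_def run.rate_def
          sg_def rg_def D_def q_def)
    define H where "H = (\<Sum>t=1..T. norm (opt_ref \<Sigma> Sbar L t - opt_ref \<Sigma> Sbar L (t - 1)))"
    have H: "(\<Sum>t<T. norm (run.\<eta> (Suc t) - run.\<eta> t)) = H"
      unfolding H_def run.\<eta>_def by (simp add: sum.atLeast1_atMost_eq)
    have gov: "a \<le> run.gov t" for t
      unfolding a_def using \<beta> \<beta>\<delta> by (intro run.gov_ge[OF \<delta>(2)]) (auto simp: eqs ND_def)
    have "regret \<Sigma> Omega Sbar \<gamma> x0 r0 L w T
        \<le> E * norm (x0 - S *v r0) + R * (D + H) / (1 - q) + E * onorm ((*v) Bw) * (\<Sum>t<T. norm (w t))"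
      using run.regret_le[OF _ M a gov, of T] q
      by (simp add: eqs H E_def R_def run.e_def)
    also have "\<dots> \<le> c0 + c\<eta> * H + cw * (\<Sum>t<T. norm (w t))"
    proof -
      have "0 \<le> H" by (simp add: H_def sum_nonneg)
      moreover have "0 \<le> (\<Sum>t<T. norm (w t))" by (simp add: sum_nonneg)
      ultimately show ?thesis
        by (simp add: c0_def c\<eta>_def cw_def algebra_simps add_divide_distrib)
    qed
    finally show ?thesis unfolding H_def .
  qed
  show ?thesis
    by (intro exI[of _ c0] exI[of _ c\<eta>] exI[of _ cw] conjI allI impI)
       (rule c_pos | (rule bound; assumption))+
qed

end
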